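(* For each $\gamma\in\{C_{max},\sum_jC_j\}$, the problem $P\,|\,or/and\text{-}prec,\,p_j=1\,|\,\gamma$ is $W[1]$-hard when parameterized by the number $k_s$ of successors.
   Context: An instance of $P\,|\,or/and\text{-}prec,\,p_j=1\,|\,\gamma$ consists of a set $J=\{1,\dots,n\}$ of unit-time jobs, a number $m$ of identical parallel machines, and for every job $j\in J$ a precedence constraint $\psi_j$, which is either the constant $\mathbb{1}$ ("true") or a Boolean formula in disjunctive normal form (a disjunction of conjunctions) over the unnegated variables $\{x_i : i\in J\}$. A schedule is a tuple $(C_j)_{j\in J}$ of completion times $C_j\in\{1,2,\dots\}$ with $|\{j\in J : C_j=t\}|\le m$ for every $t$. It is feasible if for every $j\in J$ the formula $\psi_j$ is satisfied by the assignment $x_i=1$ if $C_i<C_j$ and $x_i=0$ otherwise. All instances are assumed to admit a feasible schedule. The objective to be minimized over feasible schedules is the makespan $C_{max}=\max_j C_j$ or the sum of completion times $\sum_j C_j$. A job $j$ with $\psi_j\neq\mathbb{1}$ is called a successor, and $k_s$ is the number of successors. Hardness refers to the decision version: given an instance and a bound $T\in\mathbb{N}$, decide whether there is a feasible schedule with objective value at most $T$; $W[1]$-hardness is with respect to parameterized (FPT) reductions. *)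

theory Defs
  imports Main
begin

section \<open>Model of computation\<close>

text \<open>
  Algorithms are WHILE programs over binary trees (the language of N. Jones, ``Computability and
  Complexity''), which compute exactly the computable functions. Evaluating an expression is charged
  the total size of the values of all of its subexpressions. Hence every value that a program reads
  or builds is paid for with its full size (there is no free sharing of subtrees), and running times
  agree with those of Turing machines up to a polynomial.
\<close>

datatype tree = Leaf | Node tree tree

fun tsize :: "tree \<Rightarrow> nat" where
  "tsize Leaf = 1"
| "tsize (Node a b) = 1 + tsize a + tsize b"

type_synonym store = "nat \<Rightarrow> tree"

datatype exp = Var nat | Nil_exp | Cons_exp exp exp | Hd_exp exp | Tl_exp exp | Eq_exp exp exp

fun hd_tree :: "tree \<Rightarrow> tree" where
  "hd_tree Leaf = Leaf"
| "hd_tree (Node a b) = a"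

fun tl_tree :: "tree \<Rightarrow> tree" where
  "tl_tree Leaf = Leaf"
| "tl_tree (Node a b) = b"

definition enc_bool :: "bool \<Rightarrow> tree" where
  "enc_bool b = (if b then Node Leaf Leaf else Leaf)"

fun eval_exp :: "exp \<Rightarrow> store \<Rightarrow> tree" where
  "eval_exp (Var v) s = s v"
| "eval_exp Nil_exp s = Leaf"
| "eval_exp (Cons_exp a b) s = Node (eval_exp a s) (eval_exp b s)"
| "eval_exp (Hd_exp a) s = hd_tree (eval_exp a s)"
| "eval_exp (Tl_exp a) s = tl_tree (eval_exp a s)"
| "eval_exp (Eq_exp a b) s = enc_bool (eval_exp a s = eval_exp b s)"

fun exp_cost :: "exp \<Rightarrow> store \<Rightarrow> nat" where
  "exp_cost (Var v) s = tsize (s v)"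
| "exp_cost Nil_exp s = 1"
| "exp_cost (Cons_exp a b) s = exp_cost a s + exp_cost b s + tsize (eval_exp (Cons_exp a b) s)"
| "exp_cost (Hd_exp a) s = exp_cost a s + tsize (eval_exp (Hd_exp a) s)"
| "exp_cost (Tl_exp a) s = exp_cost a s + tsize (eval_exp (Tl_exp a) s)"
| "exp_cost (Eq_exp a b) s = exp_cost a s + exp_cost b s + tsize (eval_exp (Eq_exp a b) s)"

datatype com = Skip | Assign nat exp | Seq com com | Cond exp com com | While exp com

text \<open>\<open>exec c s t s'\<close>: started in store \<open>s\<close>, the program \<open>c\<close> halts in store \<open>s'\<close> after time \<open>t\<close>.
  The tree \<open>Leaf\<close> counts as false, every other tree as true.\<close>

inductive exec :: "com \<Rightarrow> store \<Rightarrow> nat \<Rightarrow> store \<Rightarrow> bool" where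
  Skip: "exec Skip s 1 s"
| Assign: "exec (Assign v e) s (1 + exp_cost e s) (s(v := eval_exp e s))"
| Seq: "exec c1 s t1 s' \<Longrightarrow> exec c2 s' t2 s'' \<Longrightarrow> exec (Seq c1 c2) s (1 + t1 + t2) s''"
| CondTrue: "eval_exp e s \<noteq> Leaf \<Longrightarrow> exec c1 s t s' \<Longrightarrow>
    exec (Cond e c1 c2) s (1 + exp_cost e s + t) s'"
| CondFalse: "eval_exp e s = Leaf \<Longrightarrow> exec c2 s t s' \<Longrightarrow>
    exec (Cond e c1 c2) s (1 + exp_cost e s + t) s'"
| WhileTrue: "eval_exp e s \<noteq> Leaf \<Longrightarrow> exec c s t1 s' \<Longrightarrow> exec (While e c) s' t2 s'' \<Longrightarrow>
    exec (While e c) s (1 + exp_cost e s + t1 + t2) s''"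
| WhileFalse: "eval_exp e s = Leaf \<Longrightarrow> exec (While e c) s (1 + exp_cost e s) s"

text \<open>Input and output are held in variable 0; all other variables are initially \<open>Leaf\<close>.\<close>

definition computes_within :: "com \<Rightarrow> tree \<Rightarrow> nat \<Rightarrow> tree \<Rightarrow> bool" where
  "computes_within c x t y \<longleftrightarrow>
     (\<exists>t' s'. t' \<le> t \<and> exec c ((\<lambda>_. Leaf)(0 := x)) t' s' \<and> s' 0 = y)"


section \<open>Encodings\<close>

text \<open>Natural numbers are written in binary, least significant bit first.\<close>

fun enc_nat :: "nat \<Rightarrow> tree" where
  "enc_nat n = (if n = 0 then Leaf else Node (enc_bool (odd n)) (enc_nat (n div 2)))"

declare enc_nat.simps [simp del]

fun enc_list :: "('a \<Rightarrow> tree) \<Rightarrow> 'a list \<Rightarrow> tree" where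
  "enc_list f [] = Leaf"
| "enc_list f (x # xs) = Node (f x) (enc_list f xs)"

lemma inj_enc_nat: "inj enc_nat"
proof (rule injI)
  show "x = y" if "enc_nat x = enc_nat y" for x y
    using that
  proof (induction x arbitrary: y rule: less_induct)
    case (less x)
    show ?case
    proof (cases "x = 0")
      case True
      then show ?thesis
        using less.prems by (subst (asm) (1 2) enc_nat.simps) (auto split: if_splits)
    next
      case False
      have e: "odd x = odd y" "enc_nat (x div 2) = enc_nat (y div 2)"
        using less.prems False
        by (subst (asm) (1 2) enc_nat.simps, auto simp: enc_bool_def split: if_splits)+
      have "x div 2 = y div 2"
        using less.IH[of "x div 2" "y div 2"] e(2) False by simp
      then show ?thesis
        using e(1) by (metis mult_div_mod_eq odd_iff_mod_2_eq_one parity_cases)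
    qed
  qed
qed

lemma inj_enc_list: "inj f \<Longrightarrow> inj (enc_list f)"
proof (rule injI)
  show "xs = ys" if "inj f" "enc_list f xs = enc_list f ys" for xs ys
    using that(2)
  proof (induction xs arbitrary: ys)
    case Nil
    then show ?case by (cases ys) auto
  next
    case (Cons x xs)
    then show ?case using that(1) by (cases ys) (auto dest: injD)
  qed
qed


section \<open>Parameterized problems, reductions, and the W-hierarchy\<close>

text \<open>
  A parameterized decision problem has a set of instances \<open>(x, k)\<close>, with \<open>k\<close> the parameter, and a
  set of yes-instances. The instances need not be all pairs: standing assumptions on the input,
  such as the existence of a feasible schedule, restrict them.
\<close>

record param_problem =
  instances :: "(tree \<times> nat) set"
  yes_instances :: "(tree \<times> nat) set"

definition enc_param :: "tree \<times> nat \<Rightarrow> tree" where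
  "enc_param = (\<lambda>(x, k). Node x (enc_nat k))"

definition computable :: "(nat \<Rightarrow> nat) \<Rightarrow> bool" where
  "computable f \<longleftrightarrow> (\<exists>c. \<forall>n. \<exists>t. computes_within c (enc_nat n) t (enc_nat (f n)))"

definition fpt_reducible :: "param_problem \<Rightarrow> param_problem \<Rightarrow> bool" where
  "fpt_reducible A B \<longleftrightarrow>
     (\<exists>c f g d. computable f \<and> computable g \<and>
        (\<forall>x k. (x, k) \<in> instances A \<longrightarrow>
           (\<exists>x' k'.
              computes_within c (enc_param (x, k)) (f k * tsize (enc_param (x, k)) ^ d)
                (enc_param (x', k')) \<and>
              (x', k') \<in> instances B \<and>
              ((x', k') \<in> yes_instances B \<longleftrightarrow> (x, k) \<in> yes_instances A) \<and>
              k' \<le> g k)))"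

text \<open>
  Boolean circuits. A circuit lists its gates in a topological order, a gate being referred to by
  its position; the last gate is the output. Gates of indegree 0 are the inputs.
\<close>

datatype gate = Input | NotGate nat | AndGate "nat list" | OrGate "nat list"

type_synonym circuit = "gate list"

fun preds :: "gate \<Rightarrow> nat list" where
  "preds Input = []"
| "preds (NotGate j) = [j]"
| "preds (AndGate js) = js"
| "preds (OrGate js) = js"

definition wf_circuit :: "circuit \<Rightarrow> bool" where
  "wf_circuit G \<longleftrightarrow> G \<noteq> [] \<and>
     (\<forall>i < length G. (\<forall>j \<in> set (preds (G ! i)). j < i) \<and> distinct (preds (G ! i)) \<and>
        (\<forall>js. G ! i = AndGate js \<or> G ! i = OrGate js \<longrightarrow> length js \<ge> 2))"

text \<open>As references point backwards, an assignment to the input gates extends to exactly one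
  valuation of all the gates.\<close>

fun gate_ok :: "(nat \<Rightarrow> bool) \<Rightarrow> nat \<Rightarrow> gate \<Rightarrow> bool" where
  "gate_ok v i Input \<longleftrightarrow> True"
| "gate_ok v i (NotGate j) \<longleftrightarrow> (v i \<longleftrightarrow> \<not> v j)"
| "gate_ok v i (AndGate js) \<longleftrightarrow> (v i \<longleftrightarrow> (\<forall>j \<in> set js. v j))"
| "gate_ok v i (OrGate js) \<longleftrightarrow> (v i \<longleftrightarrow> (\<exists>j \<in> set js. v j))"

definition valuation :: "circuit \<Rightarrow> (nat \<Rightarrow> bool) \<Rightarrow> bool" where
  "valuation G v \<longleftrightarrow> (\<forall>i < length G. gate_ok v i (G ! i))"

definition weight :: "circuit \<Rightarrow> (nat \<Rightarrow> bool) \<Rightarrow> nat" where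
  "weight G v = card {i. i < length G \<and> G ! i = Input \<and> v i}"

definition weighted_satisfiable :: "circuit \<Rightarrow> nat \<Rightarrow> bool" where
  "weighted_satisfiable G k \<longleftrightarrow> (\<exists>v. valuation G v \<and> v (length G - 1) \<and> weight G v = k)"

definition input_output_path :: "circuit \<Rightarrow> nat list \<Rightarrow> bool" where
  "input_output_path G p \<longleftrightarrow> p \<noteq> [] \<and> (\<forall>i \<in> set p. i < length G) \<and>
     G ! hd p = Input \<and> last p = length G - 1 \<and>
     (\<forall>l. Suc l < length p \<longrightarrow> p ! l \<in> set (preds (G ! (p ! Suc l))))"

definition large_gate :: "gate \<Rightarrow> bool" where
  "large_gate g \<longleftrightarrow> length (preds g) > 2"

definition depth_at_most :: "circuit \<Rightarrow> nat \<Rightarrow> bool" where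
  "depth_at_most G d \<longleftrightarrow> (\<forall>p. input_output_path G p \<longrightarrow> length p - 1 \<le> d)"

definition weft_at_most :: "circuit \<Rightarrow> nat \<Rightarrow> bool" where
  "weft_at_most G w \<longleftrightarrow>
     (\<forall>p. input_output_path G p \<longrightarrow> length (filter (\<lambda>i. large_gate (G ! i)) p) \<le> w)"

fun enc_gate :: "gate \<Rightarrow> tree" where
  "enc_gate Input = Node (enc_nat 0) Leaf"
| "enc_gate (NotGate j) = Node (enc_nat 1) (enc_nat j)"
| "enc_gate (AndGate js) = Node (enc_nat 2) (enc_list enc_nat js)"
| "enc_gate (OrGate js) = Node (enc_nat 3) (enc_list enc_nat js)"

definition enc_circuit :: "circuit \<Rightarrow> tree" where
  "enc_circuit = enc_list enc_gate"

lemma inj_enc_circuit: "inj enc_circuit"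
proof -
  have "inj enc_gate"
  proof (rule injI)
    show "a = b" if "enc_gate a = enc_gate b" for a b
      using that by (cases a; cases b)
        (auto dest: injD[OF inj_enc_nat] injD[OF inj_enc_list[OF inj_enc_nat]])
  qed
  then show ?thesis unfolding enc_circuit_def by (rule inj_enc_list)
qed

text \<open>Weighted circuit satisfiability for circuits of weft at most \<open>w\<close> and depth at most \<open>d\<close>,
  parameterized by the weight.\<close>

definition weighted_circuit_sat :: "nat \<Rightarrow> nat \<Rightarrow> param_problem" where
  "weighted_circuit_sat w d =
     \<lparr> instances = {(enc_circuit G, k) | G k.
         wf_circuit G \<and> weft_at_most G w \<and> depth_at_most G d},
       yes_instances = {(enc_circuit G, k) | G k.
         wf_circuit G \<and> weft_at_most G w \<and> depth_at_most G d \<and> weighted_satisfiable G k} \<rparr>"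

definition W_class :: "nat \<Rightarrow> param_problem set" where
  "W_class w = {A. \<exists>d. fpt_reducible A (weighted_circuit_sat w d)}"

definition W_hard :: "nat \<Rightarrow> param_problem \<Rightarrow> bool" where
  "W_hard w B \<longleftrightarrow> (\<forall>A \<in> W_class w. fpt_reducible A B)"


section \<open>Scheduling with or/and-precedence constraints\<close>

text \<open>\<open>DNF ts\<close> is the disjunction over \<open>ts\<close> of the conjunctions of the variables listed in each
  term.\<close>

datatype precedence = TrueConst | DNF "nat list list"

text \<open>The jobs are \<open>1, \<dots>, n\<close>, where \<open>n\<close> is the length of the list of constraints.\<close>

record sched_instance =
  machines :: nat
  constraints :: "precedence list"

definition jobs :: "sched_instance \<Rightarrow> nat set" where
  "jobs I = {1..length (constraints I)}"

definition prec_of :: "sched_instance \<Rightarrow> nat \<Rightarrow> precedence" where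
  "prec_of I j = constraints I ! (j - 1)"

definition wf_sched :: "sched_instance \<Rightarrow> bool" where
  "wf_sched I \<longleftrightarrow> jobs I \<noteq> {} \<and>
     (\<forall>j \<in> jobs I. \<forall>ts. prec_of I j = DNF ts \<longrightarrow>
        ts \<noteq> [] \<and> (\<forall>t \<in> set ts. t \<noteq> [] \<and> set t \<subseteq> jobs I))"

fun satisfies :: "(nat \<Rightarrow> bool) \<Rightarrow> precedence \<Rightarrow> bool" where
  "satisfies x TrueConst \<longleftrightarrow> True"
| "satisfies x (DNF ts) \<longleftrightarrow> (\<exists>t \<in> set ts. \<forall>i \<in> set t. x i)"

definition schedule :: "sched_instance \<Rightarrow> (nat \<Rightarrow> nat) \<Rightarrow> bool" where
  "schedule I C \<longleftrightarrow>
     (\<forall>j \<in> jobs I. C j \<ge> 1) \<and> (\<forall>t. card {j \<in> jobs I. C j = t} \<le> machines I)"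

definition feasible :: "sched_instance \<Rightarrow> (nat \<Rightarrow> nat) \<Rightarrow> bool" where
  "feasible I C \<longleftrightarrow>
     schedule I C \<and> (\<forall>j \<in> jobs I. satisfies (\<lambda>i. C i < C j) (prec_of I j))"

datatype objective = Makespan | TotalCompletionTime

fun objective_value :: "objective \<Rightarrow> sched_instance \<Rightarrow> (nat \<Rightarrow> nat) \<Rightarrow> nat" where
  "objective_value Makespan I C = Max (C ` jobs I)"
| "objective_value TotalCompletionTime I C = (\<Sum>j \<in> jobs I. C j)"

definition num_successors :: "sched_instance \<Rightarrow> nat" where
  "num_successors I = card {j \<in> jobs I. prec_of I j \<noteq> TrueConst}"

fun enc_precedence :: "precedence \<Rightarrow> tree" where
  "enc_precedence TrueConst = Leaf"
| "enc_precedence (DNF ts) = Node Leaf (enc_list (enc_list enc_nat) ts)"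

definition enc_sched :: "sched_instance \<times> nat \<Rightarrow> tree" where
  "enc_sched = (\<lambda>(I, T). Node (enc_nat (machines I))
     (Node (enc_list enc_precedence (constraints I)) (enc_nat T)))"

lemma inj_enc_sched: "inj enc_sched"
proof -
  have "inj enc_precedence"
  proof (rule injI)
    show "a = b" if "enc_precedence a = enc_precedence b" for a b
      using that by (cases a; cases b)
        (auto dest: injD[OF inj_enc_list[OF inj_enc_list[OF inj_enc_nat]]])
  qed
  from inj_enc_list[OF this] show ?thesis
    by (auto intro!: injI sched_instance.equality simp: enc_sched_def
        dest: injD injD[OF inj_enc_nat])
qed

text \<open>The decision version of \<open>P | or/and-prec, p_j = 1 | \<gamma>\<close>, parameterized by the number of
  successors. Only instances that admit a feasible schedule are considered.\<close>

definition or_and_scheduling :: "objective \<Rightarrow> param_problem" where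
  "or_and_scheduling \<gamma> =
     \<lparr> instances = {(enc_sched (I, T), num_successors I) | I T.
         wf_sched I \<and> (\<exists>C. feasible I C)},
       yes_instances = {(enc_sched (I, T), num_successors I) | I T.
         wf_sched I \<and> (\<exists>C. feasible I C \<and> objective_value \<gamma> I C \<le> T)} \<rparr>"

end

theory Submission
  imports Defs
begin

text \<open>
  Combinatorially, the scheduling problem contains the following one: given \<open>s\<close> families of subsets
  of a ground set, choose one member of each family so that the union has at most \<open>m\<close> elements. The
  elements become free jobs, the families become successors whose terms are the members, and with
  \<open>2 m\<close> jobs in total both objectives force all jobs into the time slots \<open>1\<close> and \<open>2\<close>. The successors
  then occupy slot \<open>2\<close>, so the union of the chosen members must fit into slot \<open>1\<close>.

  A circuit of weft \<open>1\<close> and bounded depth is equivalent to a disjunction, of polynomial length, of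
  conjunctions of clauses of bounded length over the inputs. There is one family for each of the \<open>k\<close>
  slots, whose members are the inputs that the slot may select, and one for the disjunct. For a
  clause of a disjunct there is an element for every way to tell, for each of its literals, which
  slot (if any) selects that input, provided that this makes the clause true. Choosing an input for a
  slot, or a disjunct, kills the elements that contradict the choice. Hence at most one element of
  each clause survives, and exactly one iff the clause is satisfied: minimizing the union means
  satisfying all clauses. For the disjuncts that are not chosen, one additional element survives per
  clause. Since slots are unary conditions on an element, \<open>k + 1\<close> successors suffice.
\<close>

section \<open>Polynomially bounded programs\<close>

text \<open>An item survives iff none of the choices kills it, so survival is a conjunction of
  conditions on single choices, whereas a clause is a disjunction. Status vectors split the clause
  into mutually exclusive conjunctions: survivors can then be counted, and "some literal holds"
  becomes "one vector survives". A clause of length \<open>l\<close> has at most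
  \<open>(k+1)^l\<close> vectors. This is polynomial since \<open>k <= length G\<close> in the
  essential case and \<open>l <= 2^(d+1)\<close> for depth \<open>d\<close>; hence the insistence on
  bounded clauses. Weft one provides them: the large conjunction on a path becomes many clauses,
  never a long one.

  Let \<open>E\<close> count the items of the disjuncts and \<open>c\<close> the clauses of all
  disjuncts. With \<open>m = E + (k+1) + c\<close> and \<open>(k+1) + 2c\<close> dummies that always
  die, at most \<open>m\<close> items are killed iff at least \<open>c\<close> survive. The
  survivors for the other disjuncts make this target independent of the guess.

  Two obstacles concern the machine model. Running times refer to concrete programs, so polynomial
  time is handled by closure rules that follow the syntax of a function. The parameter is written in
  binary and may exceed every polynomial in the input, so no program may count up to
  \<open>k\<close> before comparing it with the circuit.\<close>

inductive polyf :: "(nat \<Rightarrow> nat) \<Rightarrow> bool" where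
  polyf_const: "polyf (\<lambda>_. c)"
| polyf_id: "polyf (\<lambda>n. n)"
| polyf_add: "polyf f \<Longrightarrow> polyf g \<Longrightarrow> polyf (\<lambda>n. f n + g n)"
| polyf_mult: "polyf f \<Longrightarrow> polyf g \<Longrightarrow> polyf (\<lambda>n. f n * g n)"

text \<open>Monotonicity allows a time bound at the exact input size to be weakened to a bound at
  any upper estimate of that size.\<close>

lemma polyf_mono: "polyf h \<Longrightarrow> m \<le> n \<Longrightarrow> h m \<le> h n"
  by (induction rule: polyf.induct) (auto intro: add_mono mult_mono)

lemma polyf_comp: "polyf g \<Longrightarrow> polyf h \<Longrightarrow> polyf (\<lambda>n. g (h n))"
  by (induction rule: polyf.induct) (auto intro: polyf.intros)

lemma polyf_Suc: "polyf f \<Longrightarrow> polyf (\<lambda>n. Suc (f n))"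
  using polyf_add[OF polyf_const[of 1]] by simp

lemmas polyf_intros = polyf_const polyf_id polyf_add polyf_mult polyf_Suc

lemma polyf_bound:
  assumes "polyf h"
  shows "\<exists>a b. \<forall>n. h n \<le> a * Suc n ^ b"
  using assms
proof (induction rule: polyf.induct)
  case (polyf_const c)
  show ?case by (rule exI[of _ c], rule exI[of _ 0]) simp
next
  case polyf_id
  show ?case by (rule exI[of _ 1], rule exI[of _ 1]) simp
next
  case (polyf_add f g)
  then obtain a b a' b' where f: "\<And>n. f n \<le> a * Suc n ^ b" and g: "\<And>n. g n \<le> a' * Suc n ^ b'"
    by blast
  have "f n + g n \<le> (a + a') * Suc n ^ (b + b')" for n
  proof -
    have "f n \<le> a * Suc n ^ (b + b')"
      by (rule order_trans[OF f]) (intro mult_le_mono2 power_increasing, auto)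
    moreover have "g n \<le> a' * Suc n ^ (b + b')"
      by (rule order_trans[OF g]) (intro mult_le_mono2 power_increasing, auto)
    ultimately show ?thesis by (simp add: distrib_right)
  qed
  then show ?case by blast
next
  case (polyf_mult f g)
  then obtain a b a' b' where f: "\<And>n. f n \<le> a * Suc n ^ b" and g: "\<And>n. g n \<le> a' * Suc n ^ b'"
    by blast
  have "f n * g n \<le> (a * a') * Suc n ^ (b + b')" for n
    using mult_le_mono[OF f[of n] g[of n]] by (simp add: power_add mult_ac)
  then show ?case by blast
qed

lemma tsize_pos [simp]: "0 < tsize x" by (cases x) auto

lemma tsize_ge1: "1 \<le> tsize x" by (cases x) auto

lemma tsize_eval_exp_le: "tsize (eval_exp e s) \<le> exp_cost e s"
  by (induction e) auto

text \<open>Every assigned value is charged its full size, so a variable grows by no more than the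
  elapsed time. This is how time bounds yield output size bounds.\<close>

lemma exec_tsize_le: "exec c s t s' \<Longrightarrow> tsize (s' v) \<le> tsize (s v) + t"
  by (induction rule: exec.induct) (auto intro: order_trans[OF tsize_eval_exp_le])

lemma tsize_hd_tree_le: "tsize (hd_tree x) \<le> tsize x" by (cases x) auto
lemma tsize_tl_tree_le: "tsize (tl_tree x) \<le> tsize x" by (cases x) auto
lemma tsize_enc_bool_le: "tsize (enc_bool b) \<le> 3" by (auto simp: enc_bool_def)

section \<open>Time-bounded execution rules and basic polynomial-time functions\<close>

definition run :: "com \<Rightarrow> store \<Rightarrow> nat \<Rightarrow> (store \<Rightarrow> bool) \<Rightarrow> bool" where
  "run c s n Q \<longleftrightarrow> (\<exists>t s'. exec c s t s' \<and> t \<le> n \<and> Q s')"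

lemma run_Assign: "Q (s(v := eval_exp e s)) \<Longrightarrow> 1 + exp_cost e s \<le> n \<Longrightarrow> run (Assign v e) s n Q"
  unfolding run_def using exec.Assign by blast

lemma run_Seq:
  assumes "run c1 s n1 (\<lambda>s'. run c2 s' n2 Q)" "1 + n1 + n2 \<le> n"
  shows "run (Seq c1 c2) s n Q"
proof -
  obtain t1 s1 t2 s2 where "exec c1 s t1 s1" "t1 \<le> n1" "exec c2 s1 t2 s2" "t2 \<le> n2" "Q s2"
    using assms(1) unfolding run_def by blast
  moreover from this have "exec (Seq c1 c2) s (1 + t1 + t2) s2" by (blast intro: exec.Seq)
  ultimately show ?thesis
    unfolding run_def using assms(2) by (intro exI[of _ "1 + t1 + t2"] exI[of _ s2]) simp
qed

lemma run_Cond: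
  assumes "eval_exp e s \<noteq> Leaf \<Longrightarrow> run c1 s n' Q" "eval_exp e s = Leaf \<Longrightarrow> run c2 s n' Q"
    and "1 + exp_cost e s + n' \<le> n"
  shows "run (Cond e c1 c2) s n Q"
proof (cases "eval_exp e s = Leaf")
  case True
  then obtain t s' where "exec c2 s t s'" "t \<le> n'" "Q s'" using assms(2) unfolding run_def by blast
  then show ?thesis unfolding run_def
    using exec.CondFalse[OF True] assms(3) by (intro exI[of _ "1 + exp_cost e s + t"] exI[of _ s']) auto
next
  case False
  then obtain t s' where "exec c1 s t s'" "t \<le> n'" "Q s'" using assms(1) unfolding run_def by blast
  then show ?thesis unfolding run_def
    using exec.CondTrue[OF False] assms(3) by (intro exI[of _ "1 + exp_cost e s + t"] exI[of _ s']) auto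
qed

lemma run_WhileFalse:
  "eval_exp e s = Leaf \<Longrightarrow> Q s \<Longrightarrow> 1 + exp_cost e s \<le> n \<Longrightarrow> run (While e c) s n Q"
  unfolding run_def using exec.WhileFalse by blast

lemma run_WhileTrue:
  assumes "eval_exp e s \<noteq> Leaf" "run c s n1 (\<lambda>s'. run (While e c) s' n2 Q)"
    and "1 + exp_cost e s + n1 + n2 \<le> n"
  shows "run (While e c) s n Q"
proof -
  obtain t1 s1 t2 s2 where "exec c s t1 s1" "t1 \<le> n1" "exec (While e c) s1 t2 s2" "t2 \<le> n2" "Q s2"
    using assms(2) unfolding run_def by blast
  moreover from this have "exec (While e c) s (1 + exp_cost e s + t1 + t2) s2"
    using assms(1) by (blast intro: exec.WhileTrue)
  ultimately show ?thesis
    unfolding run_def using assms(3)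
    by (intro exI[of _ "1 + exp_cost e s + t1 + t2"] exI[of _ s2]) simp
qed

lemma run_mono: "run c s n Q \<Longrightarrow> n \<le> n' \<Longrightarrow> (\<And>s'. Q s' \<Longrightarrow> Q' s') \<Longrightarrow> run c s n' Q'"
  unfolding run_def by (meson order_trans)

text \<open>The program may use the variables from \<open>v\<close> on; it must not rely on their initial values
  (except for the input in \<open>v\<close>), and it leaves those below \<open>v\<close> intact. This makes the programs
  composable without renaming.\<close>

definition realizes ::
    "(nat \<Rightarrow> com) \<Rightarrow> (nat \<Rightarrow> nat) \<Rightarrow> ('a \<Rightarrow> tree) \<Rightarrow> ('b \<Rightarrow> tree) \<Rightarrow> ('a \<Rightarrow> 'b) \<Rightarrow> bool" where
  "realizes C h ea eb f \<longleftrightarrow> (\<forall>v s x. s v = ea x \<longrightarrow>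
     run (C v) s (h (tsize (ea x))) (\<lambda>s'. s' v = eb (f x) \<and> (\<forall>u<v. s' u = s u)))"

definition ptime :: "('a \<Rightarrow> tree) \<Rightarrow> ('b \<Rightarrow> tree) \<Rightarrow> ('a \<Rightarrow> 'b) \<Rightarrow> bool" where
  "ptime ea eb f \<longleftrightarrow> (\<exists>C h. polyf h \<and> realizes C h ea eb f)"

lemma ptimeI:
  assumes "polyf h"
    and "\<And>v s x. s v = ea x \<Longrightarrow>
      run (C v) s (h (tsize (ea x))) (\<lambda>s'. s' v = eb (f x) \<and> (\<forall>u<v. s' u = s u))"
  shows "ptime ea eb f"
  using assms unfolding ptime_def realizes_def by blast

lemma ptimeE:
  assumes "ptime ea eb f"
  obtains C h where "polyf h" "realizes C h ea eb f"
  using assms unfolding ptime_def by blast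

lemma run_call:
  assumes "realizes C h ea eb f" "polyf h" "s v = ea x" "tsize (ea x) \<le> N"
    and "\<And>s'. s' v = eb (f x) \<Longrightarrow> (\<And>u. u < v \<Longrightarrow> s' u = s u) \<Longrightarrow> Q s'"
  shows "run (C v) s (h N) Q"
proof -
  have "run (C v) s (h (tsize (ea x))) (\<lambda>s'. s' v = eb (f x) \<and> (\<forall>u<v. s' u = s u))"
    using assms(1,3) unfolding realizes_def by blast
  then show ?thesis
    by (rule run_mono) (use assms polyf_mono in auto)
qed

lemma run_call_le:
  assumes "realizes C h ea eb f" "polyf h" "s v = ea x" "tsize (ea x) \<le> N" "h N \<le> n"
    and "\<And>s'. s' v = eb (f x) \<Longrightarrow> (\<And>u. u < v \<Longrightarrow> s' u = s u) \<Longrightarrow> Q s'"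
  shows "run (C v) s n Q"
  by (rule run_mono[OF run_call[where x = x and s = s and v = v, OF assms(1-4)] assms(5)]) (use assms(6) in auto)

text \<open>The output is at most as large as the input plus the running time. Composition needs
  this, since the second program is charged for the intermediate value.\<close>

lemma ptime_output:
  assumes "ptime ea eb f"
  obtains h where "polyf h" "\<And>x. tsize (eb (f x)) \<le> h (tsize (ea x))"
proof -
  obtain C h where h: "polyf h" "realizes C h ea eb f" using assms by (rule ptimeE)
  have "tsize (eb (f x)) \<le> tsize (ea x) + h (tsize (ea x))" for x
  proof -
    have "run (C 0) (\<lambda>_. ea x) (h (tsize (ea x))) (\<lambda>s'. s' 0 = eb (f x))"
      by (rule run_call[OF h(2,1)]) auto
    then obtain t s' where "exec (C 0) (\<lambda>_. ea x) t s'" "t \<le> h (tsize (ea x))" "s' 0 = eb (f x)"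
      unfolding run_def by blast
    with exec_tsize_le[OF this(1), of 0] show ?thesis by simp
  qed
  then show ?thesis by (rule that[rotated]) (intro polyf_intros h(1))
qed

text \<open>Programs see only encodings, so a result may be reread as a value of another type with
  the same encoding, such as a number as its list of bits.\<close>

lemma ptime_recode: "ptime e ea f \<Longrightarrow> (\<And>x. ea (f x) = eb (g x)) \<Longrightarrow> ptime e eb g"
  unfolding ptime_def realizes_def by simp

lemma ptime_id: "ptime e e (\<lambda>x. x)"
  by (rule ptimeI[where C = "\<lambda>v. Assign v (Var v)" and h = "\<lambda>n. 1 + n"])
    (auto intro!: polyf_intros run_Assign)

lemma ptime_comp:
  assumes "ptime e e1 f" "ptime e1 e2 g"
  shows "ptime e e2 (\<lambda>x. g (f x))"
proof -
  obtain C1 h1 where 1: "polyf h1" "realizes C1 h1 e e1 f" using assms(1) by (rule ptimeE)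
  obtain C2 h2 where 2: "polyf h2" "realizes C2 h2 e1 e2 g" using assms(2) by (rule ptimeE)
  obtain p where p: "polyf p" "\<And>x. tsize (e1 (f x)) \<le> p (tsize (e x))"
    using ptime_output[OF assms(1)] by blast
  show ?thesis
  proof (rule ptimeI[where C = "\<lambda>v. Seq (C1 v) (C2 v)" and h = "\<lambda>n. 1 + h1 n + h2 (p n)"])
    show "polyf (\<lambda>n. 1 + h1 n + h2 (p n))" by (intro polyf_intros 1 polyf_comp[OF 2(1) p(1)])
    show "run (Seq (C1 v) (C2 v)) s (1 + h1 (tsize (e x)) + h2 (p (tsize (e x))))
       (\<lambda>s'. s' v = e2 (g (f x)) \<and> (\<forall>u<v. s' u = s u))" if "s v = e x" for v s x
      by (rule run_Seq[OF _ order.refl], rule run_call[where x = x and s = s and v = v, OF 1(2,1) that order.refl],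
          rule run_call[where x = "f x", OF 2(2,1)]) (auto intro: p)
  qed
qed

fun const_exp :: "tree \<Rightarrow> exp" where
  "const_exp Leaf = Nil_exp"
| "const_exp (Node a b) = Cons_exp (const_exp a) (const_exp b)"

lemma eval_const_exp [simp]: "eval_exp (const_exp t) s = t" by (induction t) auto

lemma cost_const_exp: "exp_cost (const_exp t) s = exp_cost (const_exp t) (\<lambda>_. Leaf)"
  by (induction t) auto

lemma ptime_const: "ptime e eb (\<lambda>_. y)"
proof (rule ptimeI[where C = "\<lambda>v. Assign v (const_exp (eb y))"
      and h = "\<lambda>n. 1 + exp_cost (const_exp (eb y)) (\<lambda>_. Leaf)"])
  show "run (Assign v (const_exp (eb y))) s (1 + exp_cost (const_exp (eb y)) (\<lambda>_. Leaf))
          (\<lambda>s'. s' v = eb y \<and> (\<forall>u<v. s' u = s u))" for v s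
    by (rule run_Assign) (simp_all add: cost_const_exp[of _ s])
qed (intro polyf_intros)

definition encp :: "('a \<Rightarrow> tree) \<Rightarrow> ('b \<Rightarrow> tree) \<Rightarrow> 'a \<times> 'b \<Rightarrow> tree" where
  "encp ea eb = (\<lambda>(x, y). Node (ea x) (eb y))"

lemma encp_simp [simp]: "encp ea eb (x, y) = Node (ea x) (eb y)" by (simp add: encp_def)

lemma tsize_encp: "tsize (encp ea eb z) = 1 + tsize (ea (fst z)) + tsize (eb (snd z))"
  by (cases z) simp

text \<open>The input stays in \<open>v\<close> and is copied to \<open>v+1\<close> and
  \<open>v+2\<close> for the two calls. The first result survives the second call, because a program
  started at \<open>v+2\<close> leaves the variables below intact.\<close>

lemma ptime_binary:
  assumes f: "ptime e ea f" and g: "ptime e eb g"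
    and op: "\<And>s a b. eval_exp (op (Var a) (Var b)) s = F (s a) (s b)"
    and F: "\<And>x. F (ea (f x)) (eb (g x)) = ec (k x)"
    and cost: "\<And>s a b. exp_cost (op (Var a) (Var b)) s \<le> 5 + 2 * tsize (s a) + 2 * tsize (s b)"
  shows "ptime e ec k"
proof -
  obtain C1 h1 where 1: "polyf h1" "realizes C1 h1 e ea f" using f by (rule ptimeE)
  obtain C2 h2 where 2: "polyf h2" "realizes C2 h2 e eb g" using g by (rule ptimeE)
  obtain p where p: "polyf p" "\<And>x. tsize (ea (f x)) \<le> p (tsize (e x))"
    using ptime_output[OF f] by blast
  obtain q where q: "polyf q" "\<And>x. tsize (eb (g x)) \<le> q (tsize (e x))"
    using ptime_output[OF g] by blast
  let ?C = "\<lambda>v. Seq (Assign (v+1) (Var v)) (Seq (C1 (v+1)) (Seq (Assign (v+2) (Var v))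
      (Seq (C2 (v+2)) (Assign v (op (Var (v+1)) (Var (v+2)))))))"
  let ?h = "\<lambda>n. 1 + (1 + n) + (1 + h1 n + (1 + (1 + n) + (1 + h2 n + (6 + 2 * p n + 2 * q n))))"
  show ?thesis
  proof (rule ptimeI[where C = ?C and h = ?h])
    show "polyf ?h" by (intro polyf_intros 1 2 p q)
    show "run (?C v) s (?h (tsize (e x))) (\<lambda>s'. s' v = ec (k x) \<and> (\<forall>u<v. s' u = s u))"
      if "s v = e x" for v s x
      apply (rule run_Seq[OF _ order.refl])
      apply (rule run_Assign)
       prefer 2 apply (simp add: that)
      apply (rule run_Seq[OF _ order.refl])
      apply (rule run_call[OF 1(2,1), where x = x])
        apply (simp add: that)
       apply simp
      apply (rule run_Seq[OF _ order.refl])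
      apply (rule run_Assign)
       prefer 2 apply (simp add: that)
      apply (rule run_Seq[OF _ order.refl])
      apply (rule run_call[OF 2(2,1), where x = x])
        apply (simp add: that)
       apply simp
      apply (rule run_Assign)
       apply (simp add: op F)
      apply (rule order_trans, rule add_left_mono, rule cost)
      using p(2)[of x] q(2)[of x] by simp
  qed
qed

lemma ptime_Pair:
  "ptime e ea f \<Longrightarrow> ptime e eb g \<Longrightarrow> ptime e (encp ea eb) (\<lambda>x. (f x, g x))"
  by (erule (1) ptime_binary[where op = Cons_exp and F = Node]) auto

lemma ptime_Cons:
  "ptime e ea f \<Longrightarrow> ptime e (enc_list ea) g \<Longrightarrow> ptime e (enc_list ea) (\<lambda>x. f x # g x)"
  by (erule (1) ptime_binary[where op = Cons_exp and F = Node]) auto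

lemma ptime_eq:
  "ptime e ea f \<Longrightarrow> ptime e ea g \<Longrightarrow> inj ea \<Longrightarrow> ptime e enc_bool (\<lambda>x. f x = g x)"
  by (erule (1) ptime_binary[where op = Eq_exp and F = "\<lambda>a b. enc_bool (a = b)"])
    (auto simp: inj_eq intro: order_trans[OF tsize_enc_bool_le])

lemma ptime_unary:
  assumes f: "ptime e ea f"
    and op: "\<And>s a. eval_exp (op (Var a)) s = F (s a)"
    and F: "\<And>x. F (ea (f x)) = ec (k x)"
    and cost: "\<And>s a. exp_cost (op (Var a)) s \<le> 2 * tsize (s a)"
  shows "ptime e ec k"
proof -
  have "ptime ea (\<lambda>x. x) (\<lambda>x. F (ea x))"
  proof (rule ptimeI[where C = "\<lambda>v. Assign v (op (Var v))" and h = "\<lambda>n. 1 + 2 * n"])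
    show "run (Assign v (op (Var v))) s (1 + 2 * tsize (ea x))
        (\<lambda>s'. s' v = F (ea x) \<and> (\<forall>u<v. s' u = s u))" if "s v = ea x" for s v x
      by (rule run_Assign) (use cost[of v s] in \<open>simp_all add: that op\<close>)
  qed (intro polyf_intros)
  from ptime_comp[OF f this] show ?thesis by (rule ptime_recode) (simp add: F)
qed

lemma ptime_fst: "ptime e (encp ea eb) f \<Longrightarrow> ptime e ea (\<lambda>x. fst (f x))"
  by (erule ptime_unary[where op = Hd_exp and F = hd_tree])
    (auto simp: encp_def tsize_hd_tree_le split: prod.split)

lemma ptime_snd: "ptime e (encp ea eb) f \<Longrightarrow> ptime e eb (\<lambda>x. snd (f x))"
  by (erule ptime_unary[where op = Tl_exp and F = tl_tree])
    (auto simp: encp_def tsize_tl_tree_le split: prod.split)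

lemma enc_bool_eq_Leaf [simp]: "enc_bool b = Leaf \<longleftrightarrow> \<not> b" by (simp add: enc_bool_def)

lemma inj_enc_bool: "inj enc_bool" by (auto simp: inj_def enc_bool_def split: if_splits)

lemma ptime_if:
  assumes b: "ptime e enc_bool b" and f: "ptime e eb f" and g: "ptime e eb g"
  shows "ptime e eb (\<lambda>x. if b x then f x else g x)"
proof -
  obtain C0 h0 where 0: "polyf h0" "realizes C0 h0 e enc_bool b" using b by (rule ptimeE)
  obtain C1 h1 where 1: "polyf h1" "realizes C1 h1 e eb f" using f by (rule ptimeE)
  obtain C2 h2 where 2: "polyf h2" "realizes C2 h2 e eb g" using g by (rule ptimeE)
  let ?C = "\<lambda>v. Seq (Assign (v+1) (Var v)) (Seq (C0 (v+1)) (Cond (Var (v+1)) (C1 v) (C2 v)))"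
  let ?h = "\<lambda>n. 1 + (1 + n) + (1 + h0 n + (1 + 3 + (h1 n + h2 n)))"
  show ?thesis
  proof (rule ptimeI[where C = ?C and h = ?h])
    show "polyf ?h" by (intro polyf_intros 0 1 2)
    show "run (?C v) s (?h (tsize (e x)))
        (\<lambda>s'. s' v = eb (if b x then f x else g x) \<and> (\<forall>u<v. s' u = s u))"
      if "s v = e x" for v s x
      apply (rule run_Seq[OF _ order.refl])
      apply (rule run_Assign)
       prefer 2 apply (simp add: that)
      apply (rule run_Seq[OF _ order.refl])
      apply (rule run_call[OF 0(2,1), where x = x])
        apply (simp add: that)
       apply simp
      apply (rule run_Cond[where n' = "h1 (tsize (e x)) + h2 (tsize (e x))"])
        apply (rule run_call_le[OF 1(2,1), where x = x, OF _ order.refl])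
          apply (auto simp: that)[3]
       apply (rule run_call_le[OF 2(2,1), where x = x, OF _ order.refl])
         apply (auto simp: that)[3]
      apply (simp add: tsize_enc_bool_le)
      done
  qed
qed

text \<open>A nonempty list is encoded like the pair of its head and tail. In the second branch,
  pairing the context with the list therefore already yields the encoding of
  \<open>(x, y, ys)\<close>.\<close>

lemma ptime_case_list:
  assumes l: "ptime e (enc_list ea) l" and f: "ptime e eb f"
    and g: "ptime (encp e (encp ea (enc_list ea))) eb (\<lambda>z. g (fst z) (fst (snd z)) (snd (snd z)))"
  shows "ptime e eb (\<lambda>x. case l x of [] \<Rightarrow> f x | y # ys \<Rightarrow> g x y ys)"
proof -
  obtain C0 h0 where 0: "polyf h0" "realizes C0 h0 e (enc_list ea) l" using l by (rule ptimeE)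
  obtain C1 h1 where 1: "polyf h1" "realizes C1 h1 e eb f" using f by (rule ptimeE)
  obtain C2 h2 where 2: "polyf h2" "realizes C2 h2 (encp e (encp ea (enc_list ea))) eb
      (\<lambda>z. g (fst z) (fst (snd z)) (snd (snd z)))" using g by (rule ptimeE)
  obtain p where p: "polyf p" "\<And>x. tsize (enc_list ea (l x)) \<le> p (tsize (e x))"
    using ptime_output[OF l] by blast
  let ?C = "\<lambda>v. Seq (Assign (v+1) (Var v)) (Seq (C0 (v+1)) (Cond (Var (v+1))
      (Seq (Assign v (Cons_exp (Var v) (Var (v+1)))) (C2 v)) (C1 v)))"
  let ?h = "\<lambda>n. 1 + (1 + n) + (1 + h0 n + (1 + p n +
      (h1 n + (1 + (2 + 2 * n + 2 * p n) + h2 (1 + n + p n)))))"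
  show ?thesis
  proof (rule ptimeI[where C = ?C and h = ?h])
    show "polyf ?h" by (intro polyf_intros 0 1 2 p polyf_comp[OF 2(1)])
    show "run (?C v) s (?h (tsize (e x)))
        (\<lambda>s'. s' v = eb (case l x of [] \<Rightarrow> f x | y # ys \<Rightarrow> g x y ys) \<and> (\<forall>u<v. s' u = s u))"
      (is "run _ _ _ ?Q")
      if v: "s v = e x" for v s x
    proof -
      have c: "run (Cond (Var (v+1)) (Seq (Assign v (Cons_exp (Var v) (Var (v+1)))) (C2 v)) (C1 v)) s'
        (1 + p (tsize (e x)) + (h1 (tsize (e x)) + (1 + (2 + 2 * tsize (e x) + 2 * p (tsize (e x))) +
          h2 (1 + tsize (e x) + p (tsize (e x)))))) ?Q"
        if s': "s' (v+1) = enc_list ea (l x)" "\<And>u. u < v + 1 \<Longrightarrow> s' u = s u" for s'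
      proof (cases "l x")
        case Nil
        show ?thesis
          apply (rule run_Cond[where n' = "h1 (tsize (e x))"])
            apply (simp add: s'[simplified] Nil)
           apply (rule run_call_le[OF 1(2,1), where x = x, OF _ order.refl])
             apply (auto simp: s'[simplified] v Nil)[3]
          using p(2)[of x] by (simp add: s'[simplified] Nil)
      next
        case (Cons y ys)
        let ?z = "(x, y, ys)"
        have z: "tsize (encp e (encp ea (enc_list ea)) ?z) \<le> 1 + tsize (e x) + p (tsize (e x))"
          using p(2)[of x] by (simp add: Cons)
        show ?thesis
          apply (rule run_Cond[where n' = "1 + (2 + 2 * tsize (e x) + 2 * p (tsize (e x))) +
              h2 (1 + tsize (e x) + p (tsize (e x)))"])
            apply (rule run_Seq[OF _ order.refl])
            apply (rule run_Assign)
             apply (rule run_call[OF 2(2,1), where x = ?z, OF _ z])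
              apply (simp add: s'[simplified] v Cons)
             apply (simp add: s'[simplified] v Cons)
          using p(2)[of x] by (auto simp: s'[simplified] v Cons)
      qed
      show ?thesis
        apply (rule run_Seq[OF _ order.refl])
        apply (rule run_Assign)
         prefer 2 apply (simp add: v)
        apply (rule run_Seq[OF _ order.refl])
        apply (rule run_call[OF 0(2,1), where x = x])
          apply (simp add: v)
         apply simp
        apply (rule c)
         apply simp_all
        done
    qed
  qed
qed

text \<open>The list is consumed in variable \<open>v + 2\<close>, the accumulator is in \<open>v + 1\<close>, and
  \<open>v\<close> keeps the context \<open>x\<close>.\<close>

definition fold_body :: "(nat \<Rightarrow> com) \<Rightarrow> nat \<Rightarrow> com" where
  "fold_body C v =
     Seq (Assign (v+3) (Cons_exp (Var v) (Cons_exp (Hd_exp (Var (v+2))) (Var (v+1)))))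
       (Seq (C (v+3)) (Seq (Assign (v+1) (Var (v+3))) (Assign (v+2) (Tl_exp (Var (v+2))))))"

text \<open>With context, list and all accumulators of size at most \<open>B\<close>, the argument
  of one call has size at most \<open>3 * B + 2\<close>; the term \<open>20 * B + 20\<close> covers
  the copying around it.\<close>

lemma run_fold_loop:
  assumes C: "realizes C h (encp e (encp ea eb)) eb (\<lambda>z. g (fst z) (fst (snd z)) (snd (snd z)))"
    and h: "polyf h" and x: "tsize (e x) \<le> B" and l: "tsize (enc_list ea ys) \<le> B"
    and B: "\<And>n. n \<le> length ys \<Longrightarrow> tsize (eb (fold (g x) (take n ys) acc)) \<le> B"
    and s: "s v = e x" "s (v+1) = eb acc" "s (v+2) = enc_list ea ys"
  shows "run (While (Var (v+2)) (fold_body C v)) s (Suc (length ys) * (h (3 * B + 2) + 20 * B + 20))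
    (\<lambda>s'. s' (v+1) = eb (fold (g x) ys acc) \<and> (\<forall>u\<le>v. s' u = s u))"
  using l B s
proof (induction ys arbitrary: acc s)
  case Nil
  show ?case by (rule run_WhileFalse) (use Nil in auto)
next
  case (Cons y ys)
  let ?K = "h (3 * B + 2) + 20 * B + 20"
  have acc: "tsize (eb acc) \<le> B" "tsize (eb (g x y acc)) \<le> B"
    using Cons.prems(2)[of 0] Cons.prems(2)[of 1] by simp_all
  have l: "tsize (ea y) + tsize (enc_list ea ys) < B" using Cons.prems(1) by simp
  note s = Cons.prems(3-5)[simplified]
  show ?case
  proof (rule run_WhileTrue)
    show "eval_exp (Var (v+2)) s \<noteq> Leaf" by (simp add: s)
    let ?Q = "\<lambda>s'. s' (v+1) = eb (g x y acc) \<and> s' (v+2) = enc_list ea ys \<and> (\<forall>u\<le>v. s' u = s u)"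
    have "run (fold_body C v) s (h (3 * B + 2) + 19 * B + 19) ?Q"
      unfolding fold_body_def
      apply (rule run_Seq[where ?n1.0 = "10 * B + 10" and ?n2.0 = "h (3 * B + 2) + 9 * B + 8"])
       apply (rule run_Assign)
        apply (rule run_Seq[where ?n1.0 = "h (3 * B + 2)" and ?n2.0 = "9 * B + 7"])
         apply (rule run_call[OF C h, where x = "(x, y, acc)"])
           apply (simp add: s)
          using x acc l apply simp
         apply (rule run_Seq[where ?n1.0 = "B + 1" and ?n2.0 = "4 * B + 4"])
          apply (rule run_Assign)
           apply (rule run_Assign)
            apply (simp add: s)
           using x acc l apply (simp_all add: s)
      done
    then show "run (fold_body C v) s (h (3 * B + 2) + 19 * B + 19) (\<lambda>s'.
      run (While (Var (v+2)) (fold_body C v)) s' (Suc (length ys) * ?K)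
        (\<lambda>s''. s'' (v+1) = eb (fold (g x) (y # ys) acc) \<and> (\<forall>u\<le>v. s'' u = s u)))"
    proof (rule run_mono[OF _ order.refl])
      fix s' assume s': "?Q s'"
      have "run (While (Var (v+2)) (fold_body C v)) s' (Suc (length ys) * ?K)
        (\<lambda>s''. s'' (v+1) = eb (fold (g x) ys (g x y acc)) \<and> (\<forall>u\<le>v. s'' u = s' u))"
        by (rule Cons.IH) (use s' l Cons.prems(2)[of "Suc _"] in \<open>auto simp: s\<close>)
      then show "run (While (Var (v+2)) (fold_body C v)) s' (Suc (length ys) * ?K)
        (\<lambda>s''. s'' (v+1) = eb (fold (g x) (y # ys) acc) \<and> (\<forall>u\<le>v. s'' u = s u))"
        by (rule run_mono) (use s' in auto)
    qed
    show "1 + exp_cost (Var (v+2)) s + (h (3 * B + 2) + 19 * B + 19) + Suc (length ys) * ?K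
      \<le> Suc (length (y # ys)) * ?K"
      using l by (simp add: s)
  qed
qed

lemma length_le_tsize_enc_list: "length ys \<le> tsize (enc_list ea ys)"
  by (induction ys) (auto simp: trans_le_add2)

text \<open>Iterating a polynomial step can produce exponentially large values, for instance by
  doubling. Hence the accumulators after every prefix of the list must be bounded
  separately.\<close>

lemma ptime_fold:
  assumes g: "ptime (encp e (encp ea eb)) eb (\<lambda>z. g (fst z) (fst (snd z)) (snd (snd z)))"
    and l: "ptime e (enc_list ea) l" and i: "ptime e eb i"
    and B: "polyf B" "\<And>x n. tsize (eb (fold (g x) (take n (l x)) (i x))) \<le> B (tsize (e x))"
  shows "ptime e eb (\<lambda>x. fold (g x) (l x) (i x))"
proof -
  obtain C h where C: "polyf h"
      "realizes C h (encp e (encp ea eb)) eb (\<lambda>z. g (fst z) (fst (snd z)) (snd (snd z)))"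
    using g by (rule ptimeE)
  obtain C1 h1 where 1: "polyf h1" "realizes C1 h1 e (enc_list ea) l" using l by (rule ptimeE)
  obtain C2 h2 where 2: "polyf h2" "realizes C2 h2 e eb i" using i by (rule ptimeE)
  obtain p where p: "polyf p" "\<And>x. tsize (enc_list ea (l x)) \<le> p (tsize (e x))"
    using ptime_output[OF l] by blast
  let ?B = "\<lambda>n. n + p n + B n"
  let ?w = "\<lambda>n. Suc (p n) * (h (3 * ?B n + 2) + 20 * ?B n + 20)"
  let ?C = "\<lambda>v. Seq (Assign (v+1) (Var v)) (Seq (C2 (v+1)) (Seq (Assign (v+2) (Var v))
      (Seq (C1 (v+2)) (Seq (While (Var (v+2)) (fold_body C v)) (Assign v (Var (v+1)))))))"
  let ?h = "\<lambda>n. 1 + (1 + n) + (1 + h2 n + (1 + (1 + n) + (1 + h1 n + (1 + ?w n + (1 + B n)))))"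
  show ?thesis
  proof (rule ptimeI[where C = ?C and h = ?h])
    show "polyf ?h" by (intro polyf_intros 1 2 p B polyf_comp[OF C(1)])
    fix v and s :: store and x
    assume v: "s v = e x"
    let ?n = "tsize (e x)"
    have loop: "run (While (Var (v+2)) (fold_body C v)) s1 (?w ?n)
      (\<lambda>s'. s' (v+1) = eb (fold (g x) (l x) (i x)) \<and> (\<forall>u\<le>v. s' u = s1 u))"
      if "s1 v = e x" "s1 (v+1) = eb (i x)" "s1 (v+2) = enc_list ea (l x)" for s1
    proof (rule run_mono[OF run_fold_loop[OF C(2,1) _ _ _ that, where B = "?B ?n"]])
      show "Suc (length (l x)) * (h (3 * ?B ?n + 2) + 20 * ?B ?n + 20) \<le> ?w ?n"
        using p(2)[of x] length_le_tsize_enc_list[of "l x" ea] by (intro mult_le_mono1) simp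
    qed (use p(2)[of x] B(2)[of x] in \<open>auto simp: trans_le_add2\<close>)
    show "run (?C v) s (?h ?n) (\<lambda>s'. s' v = eb (fold (g x) (l x) (i x)) \<and> (\<forall>u<v. s' u = s u))"
      apply (rule run_Seq[OF _ order.refl])
      apply (rule run_Assign)
       prefer 2 apply (simp add: v)
      apply (rule run_Seq[OF _ order.refl])
      apply (rule run_call[OF 2(2,1), where x = x])
        apply (simp add: v)
       apply simp
      apply (rule run_Seq[OF _ order.refl])
      apply (rule run_Assign)
       prefer 2 apply (simp add: v)
      apply (rule run_Seq[OF _ order.refl])
      apply (rule run_call[OF 1(2,1), where x = x])
        apply (simp add: v)
       apply simp
      apply (rule run_Seq[OF _ order.refl])
      apply (rule run_mono[OF loop order.refl])
         apply (simp_all add: v)[3]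
      apply (rule run_Assign)
       apply (simp add: v)
      using B(2)[of x "length (l x)"] by simp
  qed
qed

section \<open>Polynomial-time list functions\<close>

lemma enc_list_append_size:
  "tsize (enc_list f (xs @ ys)) + 1 = tsize (enc_list f xs) + tsize (enc_list f ys)"
  by (induction xs) auto

lemma tsize_enc_list_rev: "tsize (enc_list f (rev xs)) = tsize (enc_list f xs)"
proof (induction xs)
  case (Cons x xs)
  then show ?case using enc_list_append_size[of f "rev xs" "[x]"] by simp
qed simp

lemma tsize_enc_list_take_le: "tsize (enc_list f (take n xs)) \<le> tsize (enc_list f xs)"
  using enc_list_append_size[of f "take n xs" "drop n xs"] tsize_ge1[of "enc_list f (drop n xs)"]
  by simp

lemma tsize_enc_list_le:
  "(\<And>x. x \<in> set xs \<Longrightarrow> tsize (f x) \<le> B) \<Longrightarrow> tsize (enc_list f xs) \<le> 1 + length xs * (1 + B)"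
proof (induction xs)
  case (Cons x xs)
  then show ?case using Cons.prems[of x] by fastforce
qed simp

lemma tsize_elem_le: "x \<in> set xs \<Longrightarrow> tsize (f x) \<le> tsize (enc_list f xs)"
  by (induction xs) auto

lemmas ptime_base = ptime_id ptime_const ptime_fst ptime_snd ptime_Pair ptime_Cons ptime_if
  ptime_case_list ptime_eq inj_enc_nat inj_enc_bool

lemma ptime_rev_append:
  assumes "ptime e (enc_list ea) l" "ptime e (enc_list ea) l'"
  shows "ptime e (enc_list ea) (\<lambda>x. rev (l x) @ l' x)"
proof -
  obtain p where p: "polyf p" "\<And>x. tsize (enc_list ea (l x)) \<le> p (tsize (e x))"
    using ptime_output[OF assms(1)] by blast
  obtain q where q: "polyf q" "\<And>x. tsize (enc_list ea (l' x)) \<le> q (tsize (e x))"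
    using ptime_output[OF assms(2)] by blast
  have "ptime e (enc_list ea) (\<lambda>x. fold (\<lambda>y acc. y # acc) (l x) (l' x))"
  proof (rule ptime_fold[OF _ assms])
    show "ptime (encp e (encp ea (enc_list ea))) (enc_list ea) (\<lambda>z. fst (snd z) # snd (snd z))"
      by (rule ptime_base)+
    show "polyf (\<lambda>n. p n + q n)" by (intro polyf_intros p q)
    show "tsize (enc_list ea (fold (#) (take n (l x)) (l' x))) \<le> p (tsize (e x)) + q (tsize (e x))"
      for x n
      using enc_list_append_size[of ea "rev (take n (l x))" "l' x"]
        tsize_enc_list_take_le[of ea n "l x"] p(2)[of x] q(2)[of x]
      by (simp add: fold_Cons_rev tsize_enc_list_rev)
  qed
  then show ?thesis by (simp add: fold_Cons_rev)
qed

lemma ptime_rev: "ptime e (enc_list ea) l \<Longrightarrow> ptime e (enc_list ea) (\<lambda>x. rev (l x))"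
  using ptime_rev_append[OF _ ptime_const, of e ea l "[]"] by simp

lemma ptime_append:
  "ptime e (enc_list ea) l \<Longrightarrow> ptime e (enc_list ea) l' \<Longrightarrow> ptime e (enc_list ea) (\<lambda>x. l x @ l' x)"
  using ptime_rev_append[OF ptime_rev] by fastforce

lemma ptime_map:
  assumes l: "ptime e (enc_list ea) l"
    and g: "ptime (encp e ea) eb (\<lambda>z. g (fst z) (snd z))"
  shows "ptime e (enc_list eb) (\<lambda>x. map (g x) (l x))"
proof -
  obtain p where p: "polyf p" "\<And>x. tsize (enc_list ea (l x)) \<le> p (tsize (e x))"
    using ptime_output[OF l] by blast
  obtain q where q: "polyf q" "\<And>z. tsize (eb (g (fst z) (snd z))) \<le> q (tsize (encp e ea z))"
    using ptime_output[OF g] by blast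
  have f: "fold (\<lambda>y acc. g x y # acc) ys acc = rev (map (g x) ys) @ acc" for x ys acc
    by (induction ys arbitrary: acc) auto
  have "ptime e (enc_list eb) (\<lambda>x. fold (\<lambda>y acc. g x y # acc) (l x) [])"
  proof (rule ptime_fold[OF _ l ptime_const])
    show "ptime (encp e (encp ea (enc_list eb))) (enc_list eb)
        (\<lambda>z. g (fst z) (fst (snd z)) # snd (snd z))"
      by (rule ptime_Cons, rule ptime_comp[where f = "\<lambda>z. (fst z, fst (snd z))", OF _ g, simplified])
        (rule ptime_base)+
    show "polyf (\<lambda>n. 1 + p n * (1 + q (1 + n + p n)))"
      by (intro polyf_intros p polyf_comp[OF q(1)])
    show "tsize (enc_list eb (fold (\<lambda>y acc. g x y # acc) (take n (l x)) []))
        \<le> 1 + p (tsize (e x)) * (1 + q (1 + tsize (e x) + p (tsize (e x))))" for x n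
    proof -
      have "tsize (eb (g x y)) \<le> q (1 + tsize (e x) + p (tsize (e x)))" if "y \<in> set (l x)" for y
        using q(2)[of "(x, y)"] polyf_mono[OF q(1)] tsize_elem_le[OF that, of ea] p(2)[of x]
        by (auto intro: order_trans)
      moreover have "y \<in> set (l x)" if "y \<in> set (take n (l x))" for y
        using that by (rule in_set_takeD)
      ultimately have "tsize (enc_list eb (map (g x) (take n (l x))))
        \<le> 1 + length (take n (l x)) * (1 + q (1 + tsize (e x) + p (tsize (e x))))"
        using tsize_enc_list_le[of "map (g x) (take n (l x))" eb
            "q (1 + tsize (e x) + p (tsize (e x)))"] by auto
      also have "\<dots> \<le> 1 + p (tsize (e x)) * (1 + q (1 + tsize (e x) + p (tsize (e x))))"
        using length_le_tsize_enc_list[of "l x" ea] p(2)[of x]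
        by (intro add_left_mono mult_le_mono1) simp
      finally show ?thesis by (simp add: f tsize_enc_list_rev)
    qed
  qed
  from ptime_rev[OF this] show ?thesis by (simp add: f)
qed

lemma fold_append_concat: "fold (\<lambda>y acc. acc @ y) ys acc = acc @ concat ys"
  by (induction ys arbitrary: acc) auto

lemma tsize_enc_list_concat: "tsize (enc_list f (concat ys)) \<le> tsize (enc_list (enc_list f) ys)"
proof (induction ys)
  case (Cons y ys)
  then show ?case using enc_list_append_size[of f y "concat ys"] by simp
qed simp

lemma ptime_concat:
  assumes l: "ptime e (enc_list (enc_list ea)) l"
  shows "ptime e (enc_list ea) (\<lambda>x. concat (l x))"
proof -
  obtain p where p: "polyf p" "\<And>x. tsize (enc_list (enc_list ea) (l x)) \<le> p (tsize (e x))"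
    using ptime_output[OF l] by blast
  have "ptime e (enc_list ea) (\<lambda>x. fold (\<lambda>y acc. acc @ y) (l x) [])"
  proof (rule ptime_fold[OF _ l ptime_const p(1)])
    show "ptime (encp e (encp (enc_list ea) (enc_list ea))) (enc_list ea)
        (\<lambda>z. snd (snd z) @ fst (snd z))"
      by (rule ptime_base ptime_append)+
    show "tsize (enc_list ea (fold (\<lambda>y acc. acc @ y) (take n (l x)) [])) \<le> p (tsize (e x))" for x n
      using tsize_enc_list_concat[of ea "take n (l x)"] p(2)[of x]
        tsize_enc_list_take_le[of "enc_list ea" n "l x"]
      by (simp add: fold_append_concat)
  qed
  then show ?thesis by (simp add: fold_append_concat)
qed

lemma ptime_concat_map:
  assumes "ptime e (enc_list ea) l" "ptime (encp e ea) (enc_list eb) (\<lambda>z. g (fst z) (snd z))"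
  shows "ptime e (enc_list eb) (\<lambda>x. concat (map (g x) (l x)))"
  by (rule ptime_concat[OF ptime_map[OF assms]])

lemma ptime_filter:
  assumes l: "ptime e (enc_list ea) l"
    and P: "ptime (encp e ea) enc_bool (\<lambda>z. P (fst z) (snd z))"
  shows "ptime e (enc_list ea) (\<lambda>x. filter (P x) (l x))"
proof -
  have "filter (P x) ys = concat (map (\<lambda>y. if P x y then [y] else []) ys)" for x ys
    by (induction ys) auto
  then show ?thesis
    by (simp only:) (rule ptime_concat_map[OF l] ptime_if[OF P] ptime_base)+
qed

lemma ptime_disj:
  assumes "ptime e enc_bool P" "ptime e enc_bool Q"
  shows "ptime e enc_bool (\<lambda>x. P x \<or> Q x)"
proof -
  have "ptime e enc_bool (\<lambda>x. if P x then True else Q x)"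
    by (intro ptime_if ptime_const assms)
  then show ?thesis by (rule ptime_recode) simp
qed

lemma ptime_conj:
  assumes "ptime e enc_bool P" "ptime e enc_bool Q"
  shows "ptime e enc_bool (\<lambda>x. P x \<and> Q x)"
proof -
  have "ptime e enc_bool (\<lambda>x. if P x then Q x else False)"
    by (intro ptime_if ptime_const assms)
  then show ?thesis by (rule ptime_recode) simp
qed

lemma ptime_not:
  assumes "ptime e enc_bool P"
  shows "ptime e enc_bool (\<lambda>x. \<not> P x)"
proof -
  have "ptime e enc_bool (\<lambda>x. if P x then False else True)"
    by (intro ptime_if ptime_const assms)
  then show ?thesis by (rule ptime_recode) simp
qed

lemma ptime_list_ex:
  assumes l: "ptime e (enc_list ea) l"
    and P: "ptime (encp e ea) enc_bool (\<lambda>z. P (fst z) (snd z))"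
  shows "ptime e enc_bool (\<lambda>x. list_ex (P x) (l x))"
proof -
  have "list_ex (P x) ys \<longleftrightarrow> (case filter (P x) ys of [] \<Rightarrow> False | _ # _ \<Rightarrow> True)" for x ys
    by (induction ys) auto
  then show ?thesis
    by (simp only:) (rule ptime_case_list ptime_filter[OF l P] ptime_const)+
qed

lemma ptime_takeWhile:
  assumes l: "ptime e (enc_list ea) l"
    and P: "ptime (encp e ea) enc_bool (\<lambda>z. P (fst z) (snd z))"
  shows "ptime e (enc_list ea) (\<lambda>x. takeWhile (P x) (l x))"
proof -
  obtain p where p: "polyf p" "\<And>x. tsize (enc_list ea (l x)) \<le> p (tsize (e x))"
    using ptime_output[OF l] by blast
  \<comment> \<open>The flag tells that no element has failed so far; the accepted prefix is
    collected in reverse.\<close>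
  let ?g = "\<lambda>x y r. if fst r \<and> P x y then (True, y # snd r) else (False, snd r)"
  have f: "fold (?g x) ys (b, acc) =
      (b \<and> list_all (P x) ys, rev (if b then takeWhile (P x) ys else []) @ acc)"
    for x ys b acc
    by (induction ys arbitrary: b acc) auto
  have "ptime e (encp enc_bool (enc_list ea)) (\<lambda>x. fold (?g x) (l x) (True, []))"
  proof (rule ptime_fold[OF _ l ptime_const])
    show "ptime (encp e (encp ea (encp enc_bool (enc_list ea)))) (encp enc_bool (enc_list ea))
        (\<lambda>z. ?g (fst z) (fst (snd z)) (snd (snd z)))"
      by (rule ptime_conj ptime_base
          ptime_comp[where f = "\<lambda>z. (fst z, fst (snd z))", OF _ P, simplified])+
    show "polyf (\<lambda>n. 4 + p n)" by (intro polyf_intros p)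
    show "tsize (encp enc_bool (enc_list ea) (fold (?g x) (take n (l x)) (True, [])))
        \<le> 4 + p (tsize (e x))" for x n
    proof -
      obtain m where "takeWhile (P x) (take n (l x)) = take m (take n (l x))"
        by (metis takeWhile_eq_take)
      then have "tsize (enc_list ea (takeWhile (P x) (take n (l x)))) \<le> p (tsize (e x))"
        by (metis order_trans p(2) tsize_enc_list_take_le)
      then show ?thesis
        using tsize_enc_bool_le[of "list_all (P x) (take n (l x))"]
        by (simp add: f tsize_enc_list_rev)
    qed
  qed
  from ptime_rev[OF ptime_snd[OF this]] show ?thesis by (simp add: f)
qed

section \<open>Binary numbers: successor, length and numbering\<close>

fun bits :: "nat \<Rightarrow> bool list" where
  "bits n = (if n = 0 then [] else odd n # bits (n div 2))"

declare bits.simps [simp del]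

lemma enc_nat_eq_bits: "enc_nat n = enc_list enc_bool (bits n)"
proof (induction n rule: less_induct)
  case (less n)
  then show ?case by (subst enc_nat.simps, subst bits.simps) simp
qed

lemma length_bits_le: "length (bits n) \<le> n"
proof (induction n rule: less_induct)
  case (less n)
  show ?case
  proof (cases "n = 0")
    case False
    then have "length (bits (n div 2)) \<le> n div 2" "n div 2 < n" using less by simp_all
    then show ?thesis using False by (simp add: bits.simps[of n])
  qed (simp add: bits.simps)
qed

lemma tsize_enc_bools_le: "tsize (enc_list enc_bool bs) \<le> 4 * length bs + 1"
  using tsize_enc_list_le[of bs enc_bool 3] tsize_enc_bool_le by (simp add: mult.commute)

text \<open>A bound linear in the value suffices where this is applied: the numbers there are list
  lengths and positions.\<close>

lemma tsize_enc_nat_le: "tsize (enc_nat n) \<le> 4 * n + 1"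
  using tsize_enc_bools_le[of "bits n"] length_bits_le[of n] by (simp add: enc_nat_eq_bits)

text \<open>One step of binary increment, scanning from the least significant bit: the state is the
  carry and the bits written so far, in reverse. A carry left at the end becomes a new leading
  bit.\<close>

definition carry_step :: "bool \<Rightarrow> bool \<times> bool list \<Rightarrow> bool \<times> bool list" where
  "carry_step b r = (if fst r then (if b then (True, False # snd r) else (False, True # snd r))
     else (False, b # snd r))"

lemma fold_carry_step_False: "fold carry_step bs (False, acc) = (False, rev bs @ acc)"
  by (induction bs arbitrary: acc) (auto simp: carry_step_def)

lemma length_fold_carry_step: "length (snd (fold carry_step bs r)) = length bs + length (snd r)"
  by (induction bs arbitrary: r) (auto simp: carry_step_def)

lemma fold_carry_step:
  "rev (snd (fold carry_step (bits n) (True, acc))) @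
     (if fst (fold carry_step (bits n) (True, acc)) then [True] else []) = rev acc @ bits (Suc n)"
proof (induction n arbitrary: acc rule: less_induct)
  case (less n)
  show ?case
  proof (cases "n = 0")
    case True
    then show ?thesis by (simp add: bits.simps)
  next
    case False
    have d: "bits n = odd n # bits (n div 2)" "bits (Suc n) = even n # bits (Suc n div 2)"
      using False by (simp_all add: bits.simps[of n] bits.simps[of "Suc n"])
    show ?thesis
    proof (cases "even n")
      case True
      then have "Suc n div 2 = n div 2" by presburger
      then show ?thesis
        using True by (simp add: d carry_step_def[of False] fold_carry_step_False)
    next
      case odd: False
      then have "Suc n div 2 = Suc (n div 2)" by presburger
      then show ?thesis
        using odd less[of "n div 2" "False # acc"] False by (simp add: d carry_step_def[of True])
    qed
  qed
qed

lemma ptime_Suc: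
  assumes "ptime e enc_nat f"
  shows "ptime e enc_nat (\<lambda>x. Suc (f x))"
proof -
  have l: "ptime e (enc_list enc_bool) (\<lambda>x. bits (f x))"
    using assms by (rule ptime_recode) (simp add: enc_nat_eq_bits)
  obtain p where p: "polyf p" "\<And>x. tsize (enc_list enc_bool (bits (f x))) \<le> p (tsize (e x))"
    using ptime_output[OF l] by blast
  have r: "ptime e (encp enc_bool (enc_list enc_bool))
      (\<lambda>x. fold carry_step (bits (f x)) (True, []))" (is "ptime _ _ ?r")
  proof (rule ptime_fold[OF _ l ptime_const])
    show "ptime (encp e (encp enc_bool (encp enc_bool (enc_list enc_bool))))
       (encp enc_bool (enc_list enc_bool)) (\<lambda>z. carry_step (fst (snd z)) (snd (snd z)))"
      unfolding carry_step_def by (rule ptime_base)+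
    show "polyf (\<lambda>n. 5 + 4 * p n)" by (intro polyf_intros p)
    show "tsize (encp enc_bool (enc_list enc_bool) (fold carry_step (take n (bits (f x))) (True, [])))
        \<le> 5 + 4 * p (tsize (e x))" for x n
      using tsize_enc_bools_le[of "snd (fold carry_step (take n (bits (f x))) (True, []))"]
        tsize_enc_bool_le[of "fst (fold carry_step (take n (bits (f x))) (True, []))"]
        length_le_tsize_enc_list[of "bits (f x)" enc_bool] p(2)[of x]
      by (simp add: tsize_encp length_fold_carry_step)
  qed
  have "ptime e (enc_list enc_bool) (\<lambda>x. rev (snd (?r x)) @ (if fst (?r x) then [True] else []))"
    by (rule ptime_append ptime_rev ptime_if ptime_const ptime_fst[OF r] ptime_snd[OF r])+
  then show ?thesis
    by (rule ptime_recode) (simp add: fold_carry_step enc_nat_eq_bits)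
qed

lemma ptime_length:
  fixes ea :: "'a \<Rightarrow> tree"
  assumes l: "ptime e (enc_list ea) l"
  shows "ptime e enc_nat (\<lambda>x. length (l x))"
proof -
  obtain p where p: "polyf p" "\<And>x. tsize (enc_list ea (l x)) \<le> p (tsize (e x))"
    using ptime_output[OF l] by blast
  have f: "fold (\<lambda>_. Suc) ys m = length ys + m" for ys :: "'a list" and m
    by (induction ys arbitrary: m) auto
  have "ptime e enc_nat (\<lambda>x. fold (\<lambda>_. Suc) (l x) 0)"
  proof (rule ptime_fold[OF _ l ptime_const])
    show "ptime (encp e (encp ea enc_nat)) enc_nat (\<lambda>z. Suc (snd (snd z)))"
      by (rule ptime_Suc ptime_base)+
    show "polyf (\<lambda>n. 4 * p n + 1)" by (intro polyf_intros p)
    show "tsize (enc_nat (fold (\<lambda>_. Suc) (take n (l x)) 0)) \<le> 4 * p (tsize (e x)) + 1" for x n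
      using tsize_enc_nat_le[of "length (take n (l x))"] p(2)[of x]
        length_le_tsize_enc_list[of "l x" ea]
      by (simp add: f)
  qed
  then show ?thesis by (simp add: f)
qed

lemma ptime_enumerate:
  fixes ea :: "'a \<Rightarrow> tree"
  assumes l: "ptime e (enc_list ea) l"
  shows "ptime e (enc_list (encp enc_nat ea)) (\<lambda>x. enumerate m (l x))"
proof -
  obtain p where p: "polyf p" "\<And>x. tsize (enc_list ea (l x)) \<le> p (tsize (e x))"
    using ptime_output[OF l] by blast
  let ?g = "\<lambda>y r. (Suc (fst r), (fst r, y) # snd r)"
  have f: "fold ?g ys (m, acc) = (m + length ys, rev (enumerate m ys) @ acc)"
    for ys :: "'a list" and m acc
    by (induction ys arbitrary: m acc) auto
  have "ptime e (encp enc_nat (enc_list (encp enc_nat ea))) (\<lambda>x. fold ?g (l x) (m, []))"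
  proof (rule ptime_fold[OF _ l ptime_const])
    show "ptime (encp e (encp ea (encp enc_nat (enc_list (encp enc_nat ea)))))
        (encp enc_nat (enc_list (encp enc_nat ea))) (\<lambda>z. ?g (fst (snd z)) (snd (snd z)))"
      by (rule ptime_Suc ptime_base)+
    let ?m = "\<lambda>n. 4 * (m + p n) + 1"
    let ?h = "\<lambda>n. 1 + ?m n + (1 + p n * (1 + (1 + ?m n + p n)))"
    show "polyf ?h" by (intro polyf_intros p)
    show "tsize (encp enc_nat (enc_list (encp enc_nat ea)) (fold ?g (take n (l x)) (m, [])))
        \<le> ?h (tsize (e x))" for x n
    proof -
      let ?n = "tsize (e x)"
      have len: "length (take n (l x)) \<le> p ?n"
        using p(2)[of x] length_le_tsize_enc_list[of "l x" ea] by simp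
      have "tsize (encp enc_nat ea z) \<le> 1 + ?m ?n + p ?n" if "z \<in> set (enumerate m (take n (l x)))" for z
      proof -
        have "snd z \<in> set (take n (l x))" "fst z \<le> m + length (take n (l x))"
          using that by (metis enumerate_eq_zip prod.collapse set_zip_rightD)
            (use that in \<open>auto simp: in_set_enumerate_eq\<close>)
        then have "tsize (ea (snd z)) \<le> p ?n" "fst z \<le> m + p ?n"
          using tsize_elem_le[of "snd z" "l x" ea] p(2)[of x] len by (auto dest: in_set_takeD)
        then show ?thesis using tsize_enc_nat_le[of "fst z"] by (simp add: tsize_encp)
      qed
      then have "tsize (enc_list (encp enc_nat ea) (enumerate m (take n (l x))))
          \<le> 1 + length (take n (l x)) * (1 + (1 + ?m ?n + p ?n))"
        using tsize_enc_list_le[of "enumerate m (take n (l x))" "encp enc_nat ea" "1 + ?m ?n + p ?n"]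
        by simp
      also have "\<dots> \<le> 1 + p ?n * (1 + (1 + ?m ?n + p ?n))"
        using len by (intro add_left_mono mult_le_mono1)
      finally show ?thesis
        using len tsize_enc_nat_le[of "m + length (take n (l x))"]
        by (simp add: f tsize_enc_list_rev)
    qed
  qed
  from ptime_rev[OF ptime_snd[OF this]] show ?thesis by (simp add: f)
qed

lemmas ptime_rules = ptime_base ptime_rev ptime_append ptime_map ptime_concat ptime_filter
  ptime_disj ptime_conj ptime_not ptime_list_ex ptime_takeWhile ptime_Suc ptime_length
  ptime_enumerate

section \<open>The reduction\<close>

fun gate_kind :: "gate \<Rightarrow> nat" where
  "gate_kind Input = 0"
| "gate_kind (NotGate j) = 1"
| "gate_kind (AndGate js) = 2"
| "gate_kind (OrGate js) = 3"

lemma ptime_gate_kind: "ptime e enc_gate g \<Longrightarrow> ptime e enc_nat (\<lambda>x. gate_kind (g x))"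
proof (erule ptime_unary[where op = Hd_exp and F = hd_tree])
  show "hd_tree (enc_gate (g x)) = enc_nat (gate_kind (g x))" for x by (cases "g x") auto
qed (auto simp: tsize_hd_tree_le)

lemma ptime_preds:
  assumes "ptime e enc_gate g"
  shows "ptime e (enc_list enc_nat) (\<lambda>x. preds (g x))"
proof -
  \<comment> \<open>The tail of an encoded gate is already the list of predecessors, and
    \<open>Leaf\<close> is the empty one for an input. Only a negation stores a bare number, which
    is wrapped into a singleton. The encoding is the identity on trees, since the tail has no
    uniform type.\<close>
  let ?t = "\<lambda>x. tl_tree (enc_gate (g x))"
  have t: "ptime e (\<lambda>t. t) ?t"
    using assms by (rule ptime_unary[where op = Tl_exp and F = tl_tree]) (auto simp: tsize_tl_tree_le)
  have s: "ptime e (\<lambda>t. t) (\<lambda>x. Node (?t x) Leaf)"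
    using ptime_Cons[OF t ptime_const[where y = "[]"]] by (rule ptime_recode) simp
  have "ptime e (\<lambda>t. t) (\<lambda>x. if gate_kind (g x) = 1 then Node (?t x) Leaf else ?t x)"
    by (rule ptime_if[OF _ s t] ptime_eq ptime_gate_kind assms ptime_const inj_enc_nat)+
  then show ?thesis
  proof (rule ptime_recode)
    show "(if gate_kind (g x) = 1 then Node (?t x) Leaf else ?t x) = enc_list enc_nat (preds (g x))"
      for x by (cases "g x") auto
  qed
qed

lemma ptime_DNF:
  assumes "ptime e (enc_list (enc_list enc_nat)) ts"
  shows "ptime e enc_precedence (\<lambda>x. DNF (ts x))"
  using ptime_Pair[OF ptime_const[where eb = "\<lambda>_. Leaf"] assms] by (rule ptime_recode) simp

lemma ptime_comp3:
  assumes "ptime (encp e1 (encp e2 e3)) e4 (\<lambda>z. F (fst z) (fst (snd z)) (snd (snd z)))"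
    and "ptime e e1 a" "ptime e e2 b" "ptime e e3 c"
  shows "ptime e e4 (\<lambda>x. F (a x) (b x) (c x))"
  using ptime_comp[OF ptime_Pair[OF assms(2) ptime_Pair[OF assms(3,4)]] assms(1)] by simp

type_synonym clause = "(nat \<times> bool) list"

abbreviation enc_clauses :: "clause list \<Rightarrow> tree" where
  "enc_clauses \<equiv> enc_list (enc_list (encp enc_nat enc_bool))"

abbreviation enc_numbered :: "(nat \<times> gate) list \<Rightarrow> tree" where
  "enc_numbered \<equiv> enc_list (encp enc_nat enc_gate)"

text \<open>The literal \<open>(j, p)\<close> says that gate \<open>j\<close> has value \<open>p\<close>. \<open>gate_cnf\<close> is meant for gates without
  large gates below them, \<open>gate_dnf\<close> (whose result is a disjunction of conjunctions of clauses) for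
  those with at most one on every path. On other circuits the results are meaningless, but still of
  polynomial size, since the depth bound \<open>f\<close> is constant.\<close>

fun gate_cnf :: "nat \<Rightarrow> (nat \<times> gate) list \<Rightarrow> bool \<Rightarrow> nat \<Rightarrow> clause list" where
  "gate_cnf 0 N p j = []"
| "gate_cnf (Suc f) N p j = concat (map (\<lambda>z. if fst z \<noteq> j then [] else
     if gate_kind (snd z) = 0 then [[(j, p)]]
     else if gate_kind (snd z) = 1 then concat (map (\<lambda>i. gate_cnf f N (\<not> p) i) (preds (snd z)))
     else if (gate_kind (snd z) = 2) = p then concat (map (\<lambda>i. gate_cnf f N p i) (preds (snd z)))
     else (case preds (snd z) of [] \<Rightarrow> [] | a # js \<Rightarrow> (case js of [] \<Rightarrow> [] | b # _ \<Rightarrow>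
       concat (map (\<lambda>c. map (\<lambda>c'. c @ c') (gate_cnf f N p b)) (gate_cnf f N p a))))) N)"

fun gate_dnf :: "nat \<Rightarrow> (nat \<times> gate) list \<Rightarrow> bool \<Rightarrow> nat \<Rightarrow> clause list list" where
  "gate_dnf 0 N p j = []"
| "gate_dnf (Suc f) N p j = concat (map (\<lambda>z. if fst z \<noteq> j then [] else
     if gate_kind (snd z) = 0 then [[[(j, p)]]]
     else if gate_kind (snd z) = 1 then concat (map (\<lambda>i. gate_dnf f N (\<not> p) i) (preds (snd z)))
     else if (gate_kind (snd z) = 2) \<noteq> p then concat (map (\<lambda>i. gate_dnf f N p i) (preds (snd z)))
     else (case preds (snd z) of [] \<Rightarrow> [] | a # js \<Rightarrow> (case js of [] \<Rightarrow> [] | b # js' \<Rightarrow>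
       (case js' of
         [] \<Rightarrow> concat (map (\<lambda>w. map (\<lambda>w'. w @ w') (gate_dnf f N p b)) (gate_dnf f N p a))
       | _ # _ \<Rightarrow> [concat (map (\<lambda>i. gate_cnf f N p i) (preds (snd z)))])))) N)"

lemmas ptime_gate_rules = ptime_rules ptime_gate_kind ptime_preds

text \<open>The depth \<open>f\<close> is a constant, not an input: the induction builds a separate
  program and polynomial for each \<open>f\<close>, with a degree that may grow with
  \<open>f\<close>.\<close>

lemma ptime_gate_cnf_aux:
  "ptime (encp enc_numbered (encp enc_bool enc_nat)) enc_clauses
     (\<lambda>z. gate_cnf f (fst z) (fst (snd z)) (snd (snd z)))"
proof (induction f)
  case 0
  show ?case by (simp add: ptime_const)
next
  case (Suc f)
  show ?case
    unfolding gate_cnf.simps by (rule ptime_gate_rules ptime_comp3[where F = "gate_cnf f", OF Suc])+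
qed

lemmas ptime_gate_cnf = ptime_comp3[where F = "gate_cnf f" for f, OF ptime_gate_cnf_aux]

lemma ptime_gate_dnf_aux:
  "ptime (encp enc_numbered (encp enc_bool enc_nat)) (enc_list enc_clauses)
     (\<lambda>z. gate_dnf f (fst z) (fst (snd z)) (snd (snd z)))"
proof (induction f)
  case 0
  show ?case by (simp add: ptime_const)
next
  case (Suc f)
  show ?case
    unfolding gate_dnf.simps
    by (rule ptime_gate_rules ptime_comp3[where F = "gate_dnf f", OF Suc] ptime_gate_cnf)+
qed

lemmas ptime_gate_dnf = ptime_comp3[where F = "gate_dnf f" for f, OF ptime_gate_dnf_aux]

text \<open>A status \<open>r\<close> is attached to each literal of a clause: \<open>r \<noteq> k\<close> says that slot \<open>r\<close> selects the
  input of the literal, \<open>r = k\<close> that no slot does. An item \<open>(w, b, e)\<close> belongs to the \<open>w\<close>-th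
  disjunct, counted from \<open>1\<close>; it is the additional one of its clause if \<open>b\<close> is false. The items
  with \<open>w = 0\<close> are dummies: those with \<open>b\<close> are killed by every choice, those without \<open>b\<close> by none;
  their numbers make the count of jobs twice the number of machines, without any subtraction.\<close>

type_synonym item = "nat \<times> bool \<times> ((nat \<times> bool) \<times> nat) list"

fun statuses :: "nat \<Rightarrow> nat list \<Rightarrow> 'a list \<Rightarrow> ('a \<times> nat) list list" where
  "statuses 0 R c = [[]]"
| "statuses (Suc f) R c = (case c of [] \<Rightarrow> [[]] | l # ls \<Rightarrow>
     concat (map (\<lambda>r. map (\<lambda>e. (l, r) # e) (statuses f R ls)) R))"

definition clause_items :: "nat \<Rightarrow> nat list \<Rightarrow> nat \<Rightarrow> clause \<Rightarrow> ((nat \<times> bool) \<times> nat) list list" where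
  "clause_items f R k cl = filter (list_ex (\<lambda>z. (snd z \<noteq> k) = snd (fst z))) (statuses f (k # R) cl)"

definition guess_items :: "nat \<Rightarrow> nat list \<Rightarrow> nat \<Rightarrow> clause list list \<Rightarrow> item list" where
  "guess_items f R k W = concat (map (\<lambda>z. concat (map (\<lambda>cl.
     (fst z, False, []) # map (\<lambda>e. (fst z, True, e)) (clause_items f R k cl)) (snd z)))
     (enumerate 1 W))"

definition all_items :: "nat \<Rightarrow> nat list \<Rightarrow> nat \<Rightarrow> clause list list \<Rightarrow> item list" where
  "all_items f R k W = guess_items f R k W @
     map (\<lambda>_. (0, True, [])) (k # R) @
     map (\<lambda>_. (0, True, [])) (concat W) @ map (\<lambda>_. (0, True, [])) (concat W) @
     map (\<lambda>_. (0, False, [])) (guess_items f R k W)"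

text \<open>The number of machines in unary, so that sums are concatenations. Write \<open>E\<close>
  for the number of guess items and \<open>c\<close> for that of clauses. For \<open>R\<close> of
  length \<open>k\<close> this list has length \<open>m = E + (k+1) + c\<close>, and
  \<open>all_items\<close> has length \<open>2E + (k+1) + 2c\<close>, so that \<open>k+1\<close>
  successors complete it to \<open>2m\<close> jobs.\<close>

definition capacity_list :: "nat \<Rightarrow> nat list \<Rightarrow> nat \<Rightarrow> clause list list \<Rightarrow> bool list" where
  "capacity_list f R k W = map (\<lambda>_. True) (guess_items f R k W) @ map (\<lambda>_. True) (k # R) @
     map (\<lambda>_. True) (concat W)"

text \<open>Choosing disjunct \<open>w\<close> kills the genuine items of the other disjuncts and
  the additional ones of \<open>w\<close> itself. As disjuncts count from 1, the label 0 makes the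
  dummies behave alike under every choice.\<close>

definition guess_kills :: "nat \<Rightarrow> item \<Rightarrow> bool" where
  "guess_kills w it \<longleftrightarrow> (fst it = w) \<noteq> fst (snd it)"

text \<open>If slot \<open>i\<close> selects \<open>a\<close>, an item is consistent when exactly
  its literals on \<open>a\<close> carry status \<open>i\<close>. The first alternative makes every
  choice kill the dummies with a true flag, so no term is empty.\<close>

definition slot_kills :: "nat \<Rightarrow> nat \<Rightarrow> item \<Rightarrow> bool" where
  "slot_kills i a it \<longleftrightarrow> fst it = 0 \<and> fst (snd it) \<or>
     list_ex (\<lambda>l. (fst (fst l) = a) \<noteq> (snd l = i)) (snd (snd it))"

definition killed_term :: "('a \<Rightarrow> bool) \<Rightarrow> 'a list \<Rightarrow> nat list" where
  "killed_term K its = map fst (filter (\<lambda>y. K (snd y)) (enumerate 1 its))"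

definition choice_constraints :: "'a list \<Rightarrow> ('a \<Rightarrow> bool) list list \<Rightarrow> precedence list" where
  "choice_constraints its F =
     map (\<lambda>_. TrueConst) its @ map (\<lambda>Ks. DNF (map (\<lambda>K. killed_term K its) Ks)) F"

text \<open>Produces \<open>[0..<k]\<close> by cutting off the gate numbers, in time polynomial in
  the circuit although \<open>k\<close> is in binary. The extra \<open>Input\<close> supplies the
  number \<open>length G\<close> as a possible stopping point.\<close>

definition slots :: "nat \<Rightarrow> circuit \<Rightarrow> nat list" where
  "slots k G = takeWhile (\<lambda>i. i \<noteq> k) (map fst (enumerate 0 (Input # G)))"

definition inputs :: "circuit \<Rightarrow> nat list" where
  "inputs G = map fst (filter (\<lambda>z. gate_kind (snd z) = 0) (enumerate 0 G))"

definition output_dnf :: "nat \<Rightarrow> circuit \<Rightarrow> clause list list" where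
  "output_dnf f G = (case rev (enumerate 0 G) of [] \<Rightarrow> [] | z # _ \<Rightarrow>
     gate_dnf f (enumerate 0 G) True (fst z))"

text \<open>The first disjunct is unsatisfiable and only ensures that there is one. The tautologies are
  there because their items force the slots to select distinct inputs.\<close>

definition guesses :: "nat \<Rightarrow> circuit \<Rightarrow> clause list list" where
  "guesses f G = map (\<lambda>w. w @ map (\<lambda>a. [(a, True), (a, False)]) (inputs G)) ([[]] # output_dnf f G)"

definition families :: "nat \<Rightarrow> nat list \<Rightarrow> clause list list \<Rightarrow> (item \<Rightarrow> bool) list list" where
  "families n ins W = map guess_kills (map fst (enumerate 1 W)) #
     map (\<lambda>i. map (slot_kills i) ins) [0..<n]"

text \<open>The members of \<open>families\<close> are predicates, which have no encoding, so the
  constraints are spelled out here with numbers. The test amounts to \<open>k <= length G\<close>;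
  beyond that, no assignment has weight \<open>k\<close> and a fixed no-instance is returned. The
  length of \<open>M @ M @ M\<close> is \<open>3m\<close>, obtained without multiplication.\<close>

definition reduction ::
    "objective \<Rightarrow> nat \<Rightarrow> circuit \<Rightarrow> nat \<Rightarrow> (nat \<times> precedence list \<times> nat) \<times> nat" where
  "reduction \<gamma> f G k =
     (if list_ex (\<lambda>z. fst z = k) (enumerate 0 (Input # G)) then
       (let R = slots k G; W = guesses f G; M = capacity_list (2 ^ f) R k W in
         ((length M,
           map (\<lambda>_. TrueConst) (all_items (2 ^ f) R k W) @
           DNF (map (\<lambda>w. killed_term (guess_kills (fst w)) (all_items (2 ^ f) R k W)) (enumerate 1 W)) #
           map (\<lambda>i. DNF (map (\<lambda>a. killed_term (slot_kills i a) (all_items (2 ^ f) R k W)) (inputs G))) R,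
           case \<gamma> of Makespan \<Rightarrow> 2 | TotalCompletionTime \<Rightarrow> length (M @ M @ M)), Suc k))
      else ((1, [TrueConst], 0), 0))"

section \<open>Running time of the reduction\<close>

abbreviation enc_statuses :: "((nat \<times> bool) \<times> nat) list \<Rightarrow> tree" where
  "enc_statuses \<equiv> enc_list (encp (encp enc_nat enc_bool) enc_nat)"

abbreviation enc_item :: "item \<Rightarrow> tree" where
  "enc_item \<equiv> encp enc_nat (encp enc_bool enc_statuses)"

lemma ptime_comp2:
  assumes "ptime (encp e1 e2) e3 (\<lambda>z. F (fst z) (snd z))" "ptime e e1 a" "ptime e e2 b"
  shows "ptime e e3 (\<lambda>x. F (a x) (b x))"
  using ptime_comp[OF ptime_Pair[OF assms(2,3)] assms(1)] by simp

lemma ptime_statuses_aux: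
  "ptime (encp (enc_list enc_nat) (enc_list (encp enc_nat enc_bool))) (enc_list enc_statuses)
     (\<lambda>z. statuses f (fst z) (snd z))"
proof (induction f)
  case 0
  show ?case by (simp add: ptime_const)
next
  case (Suc f)
  show ?case
    unfolding statuses.simps by (rule ptime_rules ptime_comp2[where F = "statuses f", OF Suc])+
qed

lemmas ptime_statuses = ptime_comp2[where F = "statuses f" for f, OF ptime_statuses_aux]

lemma ptime_clause_items_aux:
  "ptime (encp (enc_list enc_nat) (encp enc_nat (enc_list (encp enc_nat enc_bool))))
     (enc_list enc_statuses) (\<lambda>z. clause_items f (fst z) (fst (snd z)) (snd (snd z)))"
  unfolding clause_items_def by (rule ptime_rules ptime_statuses)+

lemmas ptime_clause_items =
  ptime_comp3[where F = "clause_items f" for f, OF ptime_clause_items_aux]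

lemma ptime_guess_items_aux:
  "ptime (encp (enc_list enc_nat) (encp enc_nat (enc_list enc_clauses))) (enc_list enc_item)
     (\<lambda>z. guess_items f (fst z) (fst (snd z)) (snd (snd z)))"
  unfolding guess_items_def by (rule ptime_rules ptime_clause_items)+

lemmas ptime_guess_items =
  ptime_comp3[where F = "guess_items f" for f, OF ptime_guess_items_aux]

lemma ptime_all_items_aux:
  "ptime (encp (enc_list enc_nat) (encp enc_nat (enc_list enc_clauses))) (enc_list enc_item)
     (\<lambda>z. all_items f (fst z) (fst (snd z)) (snd (snd z)))"
  unfolding all_items_def by (rule ptime_rules ptime_guess_items)+

lemmas ptime_all_items = ptime_comp3[where F = "all_items f" for f, OF ptime_all_items_aux]

lemma ptime_capacity_list_aux:
  "ptime (encp (enc_list enc_nat) (encp enc_nat (enc_list enc_clauses))) (enc_list enc_bool)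
     (\<lambda>z. capacity_list f (fst z) (fst (snd z)) (snd (snd z)))"
  unfolding capacity_list_def by (rule ptime_rules ptime_guess_items)+

lemmas ptime_capacity_list =
  ptime_comp3[where F = "capacity_list f" for f, OF ptime_capacity_list_aux]

lemma ptime_slots_aux: "ptime (encp enc_nat (enc_list enc_gate)) (enc_list enc_nat)
    (\<lambda>z. slots (fst z) (snd z))"
  unfolding slots_def by (rule ptime_rules)+

lemmas ptime_slots = ptime_comp2[where F = slots, OF ptime_slots_aux]

lemma ptime_inputs_aux: "ptime (enc_list enc_gate) (enc_list enc_nat) inputs"
  unfolding inputs_def by (rule ptime_gate_rules)+

lemmas ptime_inputs = ptime_comp[OF _ ptime_inputs_aux]

lemma ptime_guesses_aux: "ptime (enc_list enc_gate) (enc_list enc_clauses) (guesses f)"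
  unfolding guesses_def output_dnf_def by (rule ptime_gate_rules ptime_gate_dnf ptime_inputs)+

lemmas ptime_guesses = ptime_comp[OF _ ptime_guesses_aux]

lemma ptime_Let:
  assumes "ptime e ea f" "ptime (encp e ea) eb (\<lambda>z. g (fst z) (snd z))"
  shows "ptime e eb (\<lambda>x. let y = f x in g x y)"
  using ptime_comp[OF ptime_Pair[OF ptime_id assms(1)] assms(2)] by (simp add: Let_def)

lemma ptime_reduction:
  "ptime (encp (enc_list enc_gate) enc_nat)
     (encp (encp enc_nat (encp (enc_list enc_precedence) enc_nat)) enc_nat)
     (\<lambda>z. reduction \<gamma> f (fst z) (snd z))"
proof (cases \<gamma>)
  case Makespan
  show ?thesis
    unfolding reduction_def Makespan objective.case killed_term_def guess_kills_def slot_kills_def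
    by (rule ptime_gate_rules ptime_Let ptime_slots ptime_inputs ptime_guesses ptime_all_items
        ptime_capacity_list ptime_DNF)+
next
  case TotalCompletionTime
  show ?thesis
    unfolding reduction_def TotalCompletionTime objective.case killed_term_def guess_kills_def
      slot_kills_def
    by (rule ptime_gate_rules ptime_Let ptime_slots ptime_inputs ptime_guesses ptime_all_items
        ptime_capacity_list ptime_DNF)+
qed

section \<open>Composition with a parameterized reduction\<close>

lemma le_pow_bits: "x < 2 ^ length (bits x)"
proof (induction x rule: less_induct)
  case (less x)
  show ?case
  proof (cases "x = 0")
    case False
    then have "x div 2 < 2 ^ length (bits (x div 2))" by (intro less) simp
    moreover have "bits x = odd x # bits (x div 2)" using False by (simp add: bits.simps[of x])
    ultimately show ?thesis by simp
  qed simp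
qed

lemma bits_append: "0 < y \<Longrightarrow> bits (x + 2 ^ length (bits x) * y) = bits x @ bits y"
proof (induction x rule: less_induct)
  case (less x)
  show ?case
  proof (cases "x = 0")
    case True
    then show ?thesis by (simp add: bits.simps[of 0])
  next
    case False
    let ?l = "2 ^ length (bits (x div 2)) :: nat"
    have x: "bits x = odd x # bits (x div 2)" using False by (simp add: bits.simps[of x])
    have "bits (x + 2 * ?l * y) = odd x # bits (x div 2 + ?l * y)"
    proof -
      have "(x + 2 * ?l * y) div 2 = x div 2 + ?l * y" by (simp add: mult.assoc)
      moreover have "odd (x + 2 * ?l * y) = odd x" by simp
      ultimately show ?thesis using False bits.simps[of "x + 2 * ?l * y"] by simp
    qed
    then show ?thesis using less.IH[of "x div 2"] less.prems False by (simp add: x)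
  qed
qed

text \<open>The number whose bit list is that of \<open>x\<close> written twice: a substitute for
  squaring that needs only list concatenation.\<close>

definition square_up :: "nat \<Rightarrow> nat" where
  "square_up x = x + 2 ^ length (bits x) * x"

lemma square_up_ge: "x ^ 2 \<le> square_up x"
proof -
  have "x * x \<le> 2 ^ length (bits x) * x" using less_imp_le[OF le_pow_bits[of x]] by (rule mult_le_mono1)
  then show ?thesis unfolding square_up_def power2_eq_square by linarith
qed

lemma ptime_square_up:
  assumes "ptime e enc_nat f"
  shows "ptime e enc_nat (\<lambda>x. square_up (f x))"
proof -
  have b: "ptime e (enc_list enc_bool) (\<lambda>x. bits (f x))"
    using assms by (rule ptime_recode) (simp add: enc_nat_eq_bits)
  have "bits (square_up x) = bits x @ bits x" for x
    using bits_append[of x x] by (cases "x = 0") (auto simp: square_up_def bits.simps[of 0])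
  then show ?thesis
    by (intro ptime_recode[OF ptime_append[OF b b]]) (simp add: enc_nat_eq_bits)
qed

text \<open>After \<open>n\<close> rounds of squaring from \<open>x + 2\<close> the exponent is
  \<open>2 ^ n >= n\<close>. The exact value of \<open>H\<close> is irrelevant: it serves as a
  computable factor in a time bound.\<close>

lemma ptime_dominates_power: "\<exists>H. ptime enc_nat enc_nat H \<and> (\<forall>x. (x + 2) ^ n \<le> H x)"
proof -
  have "\<exists>H. ptime enc_nat enc_nat H \<and> (\<forall>x. (x + 2) ^ (2 ^ n) \<le> H x)"
  proof (induction n)
    case 0
    have "ptime enc_nat enc_nat (\<lambda>x. Suc (Suc x))" by (intro ptime_Suc ptime_id)
    then show ?case by fastforce
  next
    case (Suc n)
    then obtain H where H: "ptime enc_nat enc_nat H" "\<And>x. (x + 2) ^ (2 ^ n) \<le> H x" by blast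
    have "(x + 2) ^ (2 ^ Suc n) \<le> square_up (H x)" for x
    proof -
      have "(x + 2) ^ (2 ^ Suc n) = ((x + 2) ^ (2 ^ n))\<^sup>2"
        by (simp add: power_mult[symmetric] mult.commute)
      also have "\<dots> \<le> (H x)\<^sup>2" by (intro power_mono H) simp
      also have "\<dots> \<le> square_up (H x)" by (rule square_up_ge)
      finally show ?thesis .
    qed
    then show ?case using ptime_square_up[OF H(1)] by blast
  qed
  then obtain H where H: "ptime enc_nat enc_nat H" "\<And>x. (x + 2) ^ (2 ^ n) \<le> H x" by blast
  have "(x + 2) ^ n \<le> (x + 2) ^ (2 ^ n)" for x :: nat
    by (intro power_increasing) (simp_all add: less_imp_le)
  then show ?thesis using H by (meson order_trans)
qed

lemma computable_ptime:
  assumes "computable f" "ptime enc_nat enc_nat h"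
  shows "computable (\<lambda>n. h (f n))"
proof -
  obtain c where c: "\<And>n. \<exists>t. computes_within c (enc_nat n) t (enc_nat (f n))"
    using assms(1) unfolding computable_def by blast
  obtain C p where C: "polyf p" "realizes C p enc_nat enc_nat h" using assms(2) by (rule ptimeE)
  have "\<exists>t. computes_within (Seq c (C 0)) (enc_nat n) t (enc_nat (h (f n)))" for n
  proof -
    obtain t1 s1 where 1: "exec c ((\<lambda>_. Leaf)(0 := enc_nat n)) t1 s1" "s1 0 = enc_nat (f n)"
      using c unfolding computes_within_def by blast
    have "run (C 0) s1 (p (tsize (enc_nat (f n)))) (\<lambda>s'. s' 0 = enc_nat (h (f n)))"
      by (rule run_call[where x = "f n", OF C(2,1)]) (auto simp: 1(2))
    then obtain t2 s2 where "exec (C 0) s1 t2 s2" "s2 0 = enc_nat (h (f n))"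
      unfolding run_def by blast
    with 1(1) show ?thesis
      unfolding computes_within_def by (blast intro: exec.Seq)
  qed
  then show ?thesis unfolding computable_def by blast
qed

text \<open>The second program runs on a value of size up to \<open>n + f k * n ^ d\<close>, so its
  time mixes \<open>k\<close> and \<open>n\<close>. The point is to separate it again into a
  computable function of \<open>k\<close> times a fixed power of \<open>n\<close>.\<close>

lemma fpt_reducible_ptime:
  assumes A: "fpt_reducible A B"
    and F: "ptime ea enc_param F" and g2: "ptime enc_nat enc_nat g2" "mono g2"
    and BC: "\<And>x k. (x, k) \<in> instances B \<Longrightarrow> \<exists>y x' k'. ea y = enc_param (x, k) \<and> F y = (x', k') \<and>
      (x', k') \<in> instances C \<and> ((x', k') \<in> yes_instances C \<longleftrightarrow> (x, k) \<in> yes_instances B) \<and> k' \<le> g2 k"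
  shows "fpt_reducible A C"
proof -
  obtain c f g d where f: "computable f" and g: "computable g"
    and AB: "\<And>x k. (x, k) \<in> instances A \<Longrightarrow> \<exists>x' k'.
      computes_within c (enc_param (x, k)) (f k * tsize (enc_param (x, k)) ^ d) (enc_param (x', k')) \<and>
      (x', k') \<in> instances B \<and> ((x', k') \<in> yes_instances B \<longleftrightarrow> (x, k) \<in> yes_instances A) \<and> k' \<le> g k"
    using A unfolding fpt_reducible_def by blast
  obtain P p where P: "polyf p" "realizes P p ea enc_param F" using F by (rule ptimeE)
  obtain a b where ab: "\<And>n. p n \<le> a * Suc n ^ b" using polyf_bound[OF P(1)] by blast
  obtain H where H: "ptime enc_nat enc_nat H" "\<And>x. (x + 2) ^ (a + Suc b) \<le> H x"
    using ptime_dominates_power by blast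
  let ?D = "Suc d * Suc b"
  have time: "1 + f k * n ^ d + p (n + f k * n ^ d) \<le> H (f k) * n ^ ?D" if n: "1 \<le> n" for n k
  proof -
    \<comment> \<open>A single product bounding the running time and the output size of the first
      program; powers of it split into a part in \<open>k\<close> and a part in
      \<open>n\<close>.\<close>
    let ?z = "(f k + 2) * n ^ Suc d"
    have z: "1 + n + f k * n ^ d \<le> ?z"
    proof -
      have "1 \<le> n ^ Suc d" "n \<le> n ^ Suc d" "n ^ d \<le> n ^ Suc d"
        using n by (simp_all add: Suc_le_eq)
      then have "1 + n + f k * n ^ d \<le> n ^ Suc d + n ^ Suc d + f k * n ^ Suc d"
        by (intro add_mono mult_le_mono2)
      then show ?thesis by (simp add: algebra_simps)
    qed
    then have z1: "1 \<le> ?z" by linarith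
    have "p (n + f k * n ^ d) \<le> a * ?z ^ b"
      by (rule order_trans[OF ab]) (intro mult_le_mono2 power_mono, use z in auto)
    also have "\<dots> \<le> a * ?z ^ Suc b" using z1 by (intro mult_le_mono2 power_increasing) auto
    finally have "1 + f k * n ^ d + p (n + f k * n ^ d) \<le> ?z ^ 1 + a * ?z ^ Suc b"
      using z n by simp
    also have "\<dots> \<le> ?z ^ Suc b + a * ?z ^ Suc b"
      using z1 by (intro add_right_mono power_increasing) auto
    also have "\<dots> = Suc a * (f k + 2) ^ Suc b * n ^ ?D"
    proof -
      have "?z ^ Suc b = (f k + 2) ^ Suc b * n ^ ?D"
        by (simp only: power_mult power_mult_distrib)
      then show ?thesis by (simp only: mult_Suc add_mult_distrib mult.assoc)
    qed
    also have "\<dots> \<le> (f k + 2) ^ a * (f k + 2) ^ Suc b * n ^ ?D"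
    proof (intro mult_le_mono1)
      \<comment> \<open>The coefficient is absorbed into a power of \<open>f k + 2\<close>; the
        summand 2 makes this base large enough even for \<open>f k = 0\<close>.\<close>
      have "Suc a \<le> 2 ^ a" by (simp add: Suc_leI)
      also have "\<dots> \<le> (f k + 2) ^ a" by (intro power_mono) auto
      finally show "Suc a \<le> (f k + 2) ^ a" .
    qed
    also have "\<dots> \<le> H (f k) * n ^ ?D"
      using H(2)[of "f k"] by (intro mult_le_mono1) (simp only: power_add)
    finally show ?thesis .
  qed
  have "\<exists>x'' k''. computes_within (Seq c (P 0)) (enc_param (x, k))
        (H (f k) * tsize (enc_param (x, k)) ^ ?D) (enc_param (x'', k'')) \<and>
      (x'', k'') \<in> instances C \<and> ((x'', k'') \<in> yes_instances C \<longleftrightarrow> (x, k) \<in> yes_instances A) \<and>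
      k'' \<le> g2 (g k)"
    if xk: "(x, k) \<in> instances A" for x k
  proof -
    let ?n = "tsize (enc_param (x, k))"
    obtain x' k' where 1: "computes_within c (enc_param (x, k)) (f k * ?n ^ d) (enc_param (x', k'))"
      "(x', k') \<in> instances B" "(x', k') \<in> yes_instances B \<longleftrightarrow> (x, k) \<in> yes_instances A" "k' \<le> g k"
      using AB[OF xk] by blast
    obtain y x'' k'' where 2: "ea y = enc_param (x', k')" "F y = (x'', k'')"
      "(x'', k'') \<in> instances C" "(x'', k'') \<in> yes_instances C \<longleftrightarrow> (x', k') \<in> yes_instances B"
      "k'' \<le> g2 k'"
      using BC[OF 1(2)] by blast
    obtain t1 s1 where t1: "t1 \<le> f k * ?n ^ d"
      "exec c ((\<lambda>_. Leaf)(0 := enc_param (x, k))) t1 s1" "s1 0 = ea y"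
      using 1(1) 2(1) unfolding computes_within_def by metis
    have "tsize (ea y) \<le> ?n + f k * ?n ^ d"
      using exec_tsize_le[OF t1(2), of 0] t1(1,3) by simp
    then have "run (P 0) s1 (p (?n + f k * ?n ^ d)) (\<lambda>s'. s' 0 = enc_param (F y))"
      by (intro run_call[where x = y, OF P(2,1)]) (auto simp: t1(3))
    then obtain t2 s2 where "t2 \<le> p (?n + f k * ?n ^ d)" "exec (P 0) s1 t2 s2"
      "s2 0 = enc_param (x'', k'')"
      unfolding run_def 2(2) by blast
    moreover from this t1 have "1 + t1 + t2 \<le> H (f k) * ?n ^ ?D"
      using time[of ?n k] tsize_ge1[of "enc_param (x, k)"] by linarith
    ultimately have "computes_within (Seq c (P 0)) (enc_param (x, k)) (H (f k) * ?n ^ ?D)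
        (enc_param (x'', k''))"
      unfolding computes_within_def using t1(2) by (blast intro: exec.Seq)
    moreover have "k'' \<le> g2 (g k)" using 2(5) monoD[OF g2(2) 1(4)] by linarith
    ultimately show ?thesis using 1 2 by blast
  qed
  then show ?thesis
    unfolding fpt_reducible_def
    using computable_ptime[OF f H(1)] computable_ptime[OF g g2(1)]
    by (intro exI[of _ "Seq c (P 0)"] exI[of _ "\<lambda>k. H (f k)"] exI[of _ "\<lambda>k. g2 (g k)"] exI[of _ ?D])
      simp
qed

section \<open>Schedules as choices\<close>

lemma set_killed_term: "set (killed_term K its) = Suc ` {i. i < length its \<and> K (its ! i)}"
proof (rule set_eqI)
  fix j
  have "j \<in> set (killed_term K its) \<longleftrightarrow> (\<exists>y. (j, y) \<in> set (enumerate 1 its) \<and> K y)"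
    by (force simp: killed_term_def)
  also have "\<dots> \<longleftrightarrow> 1 \<le> j \<and> j < length its + 1 \<and> K (its ! (j - 1))"
    by (auto simp: in_set_enumerate_eq)
  also have "\<dots> \<longleftrightarrow> j \<in> Suc ` {i. i < length its \<and> K (its ! i)}"
    by (cases j) auto
  finally show "j \<in> set (killed_term K its) \<longleftrightarrow> j \<in> Suc ` {i. i < length its \<and> K (its ! i)}" .
qed

fun bound_for :: "objective \<Rightarrow> nat \<Rightarrow> nat" where
  "bound_for Makespan m = 2"
| "bound_for TotalCompletionTime m = 3 * m"

text \<open>\<open>kills_some\<close> makes the terms nonempty, as well-formedness requires.
  \<open>families_le\<close> leaves at least \<open>m\<close> free jobs, enough to fill slot 1
  without any successor.\<close>

locale choice_instance =
  fixes its :: "'a list" and F :: "('a \<Rightarrow> bool) list list" and m :: nat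
  assumes F_nonempty: "F \<noteq> []"
    and family_nonempty: "\<And>Ks. Ks \<in> set F \<Longrightarrow> Ks \<noteq> []"
    and kills_some: "\<And>Ks K. Ks \<in> set F \<Longrightarrow> K \<in> set Ks \<Longrightarrow> \<exists>it\<in>set its. K it"
    and job_count: "length its + length F = 2 * m"
    and families_le: "length F \<le> m"
begin

abbreviation "n \<equiv> length its"

definition "I = \<lparr>machines = m, constraints = choice_constraints its F\<rparr>"

lemma jobs_I: "jobs I = {1..2 * m}"
  using job_count by (simp add: jobs_def I_def choice_constraints_def)

lemma card_jobs: "card (jobs I) = 2 * m" by (simp add: jobs_I)

lemma finite_jobs: "finite (jobs I)" by (simp add: jobs_I)

lemma m_pos: "0 < m" using families_le F_nonempty by (cases F) auto

lemma schedule_I: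
  "schedule I C \<longleftrightarrow> (\<forall>j\<in>jobs I. 1 \<le> C j) \<and> (\<forall>t. card {j \<in> jobs I. C j = t} \<le> m)"
  by (simp add: schedule_def I_def)

lemma prec_free: "1 \<le> j \<Longrightarrow> j \<le> n \<Longrightarrow> prec_of I j = TrueConst"
  by (cases j) (auto simp: prec_of_def I_def choice_constraints_def nth_append)

lemma prec_succ: "i < length F \<Longrightarrow>
    prec_of I (Suc (n + i)) = DNF (map (\<lambda>K. killed_term K its) (F ! i))"
  by (simp add: prec_of_def I_def choice_constraints_def nth_append)

lemma job_cases:
  assumes "j \<in> jobs I"
  obtains "1 \<le> j" "j \<le> n" | i where "i < length F" "j = Suc (n + i)"
proof (cases "j \<le> n")
  case False
  then have "j - Suc n < length F" "j = Suc (n + (j - Suc n))"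
    using assms job_count by (auto simp: jobs_I)
  then show ?thesis using that by blast
qed (use that assms in \<open>auto simp: jobs_I\<close>)

lemma succ_job: "i < length F \<Longrightarrow> Suc (n + i) \<in> jobs I"
  using job_count by (simp add: jobs_I)

lemma killed_term_jobs: "i \<in> set (killed_term K its) \<Longrightarrow> i \<in> jobs I \<and> i \<le> n"
  using job_count by (auto simp: set_killed_term jobs_I)

lemma killed_term_nonempty:
  assumes "i < length F" "K \<in> set (F ! i)"
  shows "killed_term K its \<noteq> []"
proof -
  obtain it where "it \<in> set its" "K it" using kills_some[of "F ! i" K] assms by auto
  then have "set (killed_term K its) \<noteq> {}" by (auto simp: set_killed_term in_set_conv_nth)
  then show ?thesis by auto
qed

lemma wf_I: "wf_sched I"
  unfolding wf_sched_def
proof (intro conjI ballI allI impI)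
  show "jobs I \<noteq> {}" using m_pos by (simp add: jobs_I)
  fix j ts assume j: "j \<in> jobs I" and ts: "prec_of I j = DNF ts"
  obtain i where i: "i < length F" "j = Suc (n + i)"
    using j by (cases rule: job_cases) (use prec_free ts in auto)
  have ts': "ts = map (\<lambda>K. killed_term K its) (F ! i)" using ts prec_succ[OF i(1)] i(2) by simp
  show "ts \<noteq> []" using family_nonempty[of "F ! i"] i(1) by (simp add: ts')
  fix t assume "t \<in> set ts"
  then obtain K where K: "K \<in> set (F ! i)" "t = killed_term K its" by (auto simp: ts')
  show "t \<noteq> []" using killed_term_nonempty[OF i(1) K(1)] K(2) by simp
  show "set t \<subseteq> jobs I" using killed_term_jobs K(2) by blast
qed

lemma feasible_iff: "feasible I C \<longleftrightarrow> schedule I C \<and>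
    (\<forall>i<length F. \<exists>K\<in>set (F ! i). \<forall>l\<in>set (killed_term K its). C l < C (Suc (n + i)))"
proof -
  have "(\<forall>j\<in>jobs I. satisfies (\<lambda>i. C i < C j) (prec_of I j)) \<longleftrightarrow>
    (\<forall>i<length F. satisfies (\<lambda>l. C l < C (Suc (n + i))) (prec_of I (Suc (n + i))))"
    (is "?l \<longleftrightarrow> ?r")
  proof
    show ?l if ?r
    proof
      fix j assume "j \<in> jobs I"
      then show "satisfies (\<lambda>i. C i < C j) (prec_of I j)"
        by (cases rule: job_cases) (use that in \<open>auto simp: prec_free\<close>)
    qed
  qed (use succ_job in auto)
  then show ?thesis by (auto simp: feasible_def prec_succ)
qed

text \<open>One job per time step in numerical order: all terms consist of free jobs, which are
  numbered before the successors.\<close>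

lemma feasible_exists: "\<exists>C. feasible I C"
proof
  have "card {j \<in> jobs I. j = t} \<le> m" for t
  proof -
    have "card {j \<in> jobs I. j = t} \<le> card {t}" by (intro card_mono) auto
    then show ?thesis using m_pos by simp
  qed
  then have "schedule I (\<lambda>j. j)" unfolding schedule_I by (auto simp: jobs_I)
  moreover have "\<exists>K\<in>set (F ! i). \<forall>l\<in>set (killed_term K its). l < Suc (n + i)" if i: "i < length F" for i
  proof -
    obtain K where "K \<in> set (F ! i)"
      using family_nonempty[OF nth_mem[OF i]] by (cases "F ! i") auto
    then show ?thesis by (fastforce dest: killed_term_jobs)
  qed
  ultimately show "feasible I (\<lambda>j. j)" by (simp add: feasible_iff)
qed

lemma num_successors_I: "num_successors I = length F"
proof -
  have "{j \<in> jobs I. prec_of I j \<noteq> TrueConst} = (\<lambda>i. Suc (n + i)) ` {..<length F}" (is "?l = ?r")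
  proof
    show "?l \<subseteq> ?r" by (auto elim!: job_cases dest: prec_free)
    show "?r \<subseteq> ?l" using succ_job by (auto simp: prec_succ)
  qed
  then show ?thesis by (simp add: num_successors_def card_image inj_on_def)
qed

text \<open>For the sum: at most \<open>m\<close> of the \<open>2m\<close> jobs finish at time 1 and
  all others at time 2 or later, so \<open>3m\<close> is the least possible total, and one job later
  than time 2 exceeds it.\<close>

lemma two_slots:
  assumes s: "schedule I C" and b: "objective_value \<gamma> I C \<le> bound_for \<gamma> m" and j: "j \<in> jobs I"
  shows "C j \<le> 2"
proof (cases \<gamma>)
  case Makespan
  have "C j \<le> Max (C ` jobs I)" using j finite_jobs by (intro Max_ge) auto
  then show ?thesis using b Makespan by simp
next
  case TotalCompletionTime
  show ?thesis
  proof (rule ccontr)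
    assume "\<not> C j \<le> 2"
    let ?A = "{j \<in> jobs I. C j = 1}"
    have "(\<Sum>i\<in>jobs I. 2 + (if i = j then 1 else 0)) \<le> (\<Sum>i\<in>jobs I. C i + (if i \<in> ?A then 1 else 0))"
    proof (rule sum_mono)
      fix i assume i: "i \<in> jobs I"
      then have "1 \<le> C i" using s by (auto simp: schedule_I)
      then show "2 + (if i = j then 1 else 0) \<le> C i + (if i \<in> ?A then 1 else 0)"
        using \<open>\<not> C j \<le> 2\<close> i by auto
    qed
    moreover have "(\<Sum>i\<in>jobs I. (if i \<in> ?A then 1 else 0)) = card ?A"
      using finite_jobs by (simp add: sum.If_cases Int_def)
    moreover have "card ?A \<le> m" using s by (simp add: schedule_I)
    moreover have "(\<Sum>i\<in>jobs I. C i) \<le> 3 * m" using b TotalCompletionTime by simp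
    moreover have "(\<Sum>i\<in>jobs I. 2 + (if i = j then 1 else 0 :: nat)) = 4 * m + 1"
      using j finite_jobs card_jobs by (simp only: sum.distrib) simp
    ultimately show False by (simp only: sum.distrib)
  qed
qed

lemma yes_iff: "(\<exists>C. feasible I C \<and> objective_value \<gamma> I C \<le> bound_for \<gamma> m) \<longleftrightarrow>
  (\<exists>ch. (\<forall>i<length F. ch i \<in> set (F ! i)) \<and>
     length (filter (\<lambda>it. \<exists>i<length F. ch i it) its) \<le> m)"
proof
  assume "\<exists>C. feasible I C \<and> objective_value \<gamma> I C \<le> bound_for \<gamma> m"
  then obtain C where C: "feasible I C" "objective_value \<gamma> I C \<le> bound_for \<gamma> m" by blast
  then have s: "schedule I C" by (simp add: feasible_iff)
  have le2: "C j \<le> 2" if "j \<in> jobs I" for j by (rule two_slots[OF s C(2) that])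
  have ge1: "1 \<le> C j" if "j \<in> jobs I" for j using s that by (simp add: schedule_I)
  obtain ch where ch: "\<And>i. i < length F \<Longrightarrow> ch i \<in> set (F ! i)"
    "\<And>i l. i < length F \<Longrightarrow> l \<in> set (killed_term (ch i) its) \<Longrightarrow> C l < C (Suc (n + i))"
    using C(1) unfolding feasible_iff by metis
  let ?P = "\<lambda>it. \<exists>i<length F. ch i it"
  have "Suc ` {l. l < n \<and> ?P (its ! l)} \<subseteq> {j \<in> jobs I. C j = 1}"
  proof
    fix l assume "l \<in> Suc ` {l. l < n \<and> ?P (its ! l)}"
    then obtain i where i: "i < length F" "l \<in> set (killed_term (ch i) its)"
      by (auto simp: set_killed_term)
    then have "l \<in> jobs I" using killed_term_jobs by blast
    moreover have "C l < 2" using ch(2)[OF i] le2[OF succ_job[OF i(1)]] by simp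
    ultimately show "l \<in> {j \<in> jobs I. C j = 1}" using ge1[of l] by simp
  qed
  then have "card (Suc ` {l. l < n \<and> ?P (its ! l)}) \<le> card {j \<in> jobs I. C j = 1}"
    using finite_jobs by (intro card_mono) auto
  also have "\<dots> \<le> m" using s by (simp add: schedule_I)
  finally have "length (filter ?P its) \<le> m"
    by (simp add: card_image length_filter_conv_card)
  then show "\<exists>ch. (\<forall>i<length F. ch i \<in> set (F ! i)) \<and>
     length (filter (\<lambda>it. \<exists>i<length F. ch i it) its) \<le> m"
    using ch(1) by blast
next
  assume "\<exists>ch. (\<forall>i<length F. ch i \<in> set (F ! i)) \<and>
     length (filter (\<lambda>it. \<exists>i<length F. ch i it) its) \<le> m"
  then obtain ch where ch: "\<And>i. i < length F \<Longrightarrow> ch i \<in> set (F ! i)"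
    "length (filter (\<lambda>it. \<exists>i<length F. ch i it) its) \<le> m" by blast
  let ?U = "Suc ` {l. l < n \<and> (\<exists>i<length F. ch i (its ! l))}"
  have "card ?U \<le> m" using ch(2) by (simp add: card_image length_filter_conv_card)
  moreover have "?U \<subseteq> {1..n}" by auto
  moreover have "m \<le> card {1..n}" using job_count families_le by simp
  \<comment> \<open>The killed jobs are filled up to exactly \<open>m\<close> free jobs for slot 1.
    The other \<open>m\<close> jobs, among them all successors, then fit into slot 2.\<close>
  ultimately obtain T where T: "?U \<subseteq> T" "T \<subseteq> {1..n}" "card T = m"
    using exists_subset_between[of ?U m "{1..n}"] by auto
  let ?C = "\<lambda>j. if j \<in> T then 1 else 2 :: nat"
  have Tj: "T \<subseteq> jobs I" using T(2) job_count by (auto simp: jobs_I)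
  have c: "card {j \<in> jobs I. ?C j = t} \<le> m" for t
  proof -
    have "{j \<in> jobs I. ?C j = t} = (if t = 1 then T else if t = 2 then jobs I - T else {})"
      using Tj by auto
    moreover have "card (jobs I - T) = m"
      using Tj T(3) card_jobs finite_jobs finite_subset[OF Tj] by (simp add: card_Diff_subset)
    ultimately show ?thesis using T(3) by simp
  qed
  have "feasible I ?C"
    unfolding feasible_iff
  proof (intro conjI allI impI)
    show "schedule I ?C" using c by (simp add: schedule_I)
    fix i assume i: "i < length F"
    have "?C l < ?C (Suc (n + i))" if "l \<in> set (killed_term (ch i) its)" for l
    proof -
      have "l \<in> T" using T(1) that i by (auto simp: set_killed_term)
      moreover have "Suc (n + i) \<notin> T" using T(2) by auto
      ultimately show ?thesis by simp
    qed
    then show "\<exists>K\<in>set (F ! i). \<forall>l\<in>set (killed_term K its). ?C l < ?C (Suc (n + i))"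
      using ch(1)[OF i] by blast
  qed
  moreover have "objective_value \<gamma> I ?C \<le> bound_for \<gamma> m"
  proof (cases \<gamma>)
    case Makespan
    have "Max (?C ` jobs I) \<le> 2"
    proof (rule Max.boundedI)
      have "jobs I \<noteq> {}" using wf_I by (simp add: wf_sched_def)
      then show "?C ` jobs I \<noteq> {}" by blast
    qed (use finite_jobs in auto)
    then show ?thesis using Makespan by simp
  next
    case TotalCompletionTime
    have "(\<Sum>j\<in>jobs I. ?C j) + (\<Sum>j\<in>jobs I. if j \<in> T then 1 else 0) = (\<Sum>j\<in>jobs I. 2)"
      by (subst sum.distrib[symmetric], rule sum.cong) auto
    moreover have "(\<Sum>j\<in>jobs I. if j \<in> T then 1 else 0) = card T"
      using finite_jobs Tj by (simp add: sum.If_cases Int_absorb1)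
    ultimately show ?thesis using TotalCompletionTime T(3) card_jobs by simp
  qed
  ultimately show "\<exists>C. feasible I C \<and> objective_value \<gamma> I C \<le> bound_for \<gamma> m" by blast
qed

end

section \<open>Circuits of weft one\<close>

lemma concat_map_enumerate_less:
  "j < m \<Longrightarrow> concat (map (\<lambda>z. if fst z \<noteq> j then [] else h z) (enumerate m xs)) = []"
proof (induction xs arbitrary: m)
  case (Cons x xs)
  from Cons.prems Cons.IH[of "Suc m"] show ?case
    by (simp del: concat_eq_Nil_conv)
qed simp

text \<open>Gates are looked up by scanning the numbered list. Exactly one entry carries the wanted
  number, so the concatenation collapses to its contribution.\<close>

lemma concat_map_enumerate:
  "j < length xs \<Longrightarrow>
    concat (map (\<lambda>z. if fst z \<noteq> m + j then [] else h z) (enumerate m xs)) = h (m + j, xs ! j)"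
proof (induction xs arbitrary: m j)
  case (Cons x xs)
  show ?case
  proof (cases j)
    case 0
    then show ?thesis using concat_map_enumerate_less[of m "Suc m" h xs] by simp
  next
    case (Suc i)
    then show ?thesis using Cons.IH[of i "Suc m"] Cons.prems by simp
  qed
qed simp

lemmas concat_map_enumerate0 = concat_map_enumerate[where m = 0, simplified]

definition sat_clause :: "(nat \<Rightarrow> bool) \<Rightarrow> clause \<Rightarrow> bool" where
  "sat_clause v c \<longleftrightarrow> (\<exists>l\<in>set c. v (fst l) = snd l)"

definition sat_cnf :: "(nat \<Rightarrow> bool) \<Rightarrow> clause list \<Rightarrow> bool" where
  "sat_cnf v cs \<longleftrightarrow> (\<forall>c\<in>set cs. sat_clause v c)"

lemma sat_cnf_concat_map: "sat_cnf v (concat (map h xs)) \<longleftrightarrow> (\<forall>x\<in>set xs. sat_cnf v (h x))"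
  by (auto simp: sat_cnf_def)

lemma sat_cnf_append: "sat_cnf v (xs @ ys) \<longleftrightarrow> sat_cnf v xs \<and> sat_cnf v ys"
  by (auto simp: sat_cnf_def)

lemma sat_cnf_product:
  "sat_cnf v (concat (map (\<lambda>c. map (\<lambda>c'. c @ c') B) A)) \<longleftrightarrow> sat_cnf v A \<or> sat_cnf v B"
proof -
  have "sat_clause v (c @ c') \<longleftrightarrow> sat_clause v c \<or> sat_clause v c'" for c c'
    by (auto simp: sat_clause_def)
  then show ?thesis by (auto simp: sat_cnf_def)
qed

text \<open>The recursion mirrors \<open>gate_cnf\<close>: \<open>f\<close> bounds the number of
  gates on a path ending in \<open>j\<close>, so it also certifies that the recursion depth
  suffices.\<close>

fun small_below :: "circuit \<Rightarrow> nat \<Rightarrow> nat \<Rightarrow> bool" where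
  "small_below G 0 j \<longleftrightarrow> False"
| "small_below G (Suc f) j \<longleftrightarrow> j < length G \<and> \<not> large_gate (G ! j) \<and>
     (\<forall>i\<in>set (preds (G ! j)). small_below G f i)"

fun weft1_below :: "circuit \<Rightarrow> nat \<Rightarrow> nat \<Rightarrow> bool" where
  "weft1_below G 0 j \<longleftrightarrow> False"
| "weft1_below G (Suc f) j \<longleftrightarrow> j < length G \<and>
     (\<forall>i\<in>set (preds (G ! j)). if large_gate (G ! j) then small_below G f i else weft1_below G f i)"

lemma small_imp_weft1: "small_below G f j \<Longrightarrow> weft1_below G f j"
  by (induction f arbitrary: j) auto

lemma two_preds:
  assumes "2 \<le> length js" "\<not> large_gate g" "preds g = js"
  obtains a b where "js = [a, b]"
proof -
  have "length js = Suc (Suc 0)" using assms by (simp add: large_gate_def)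
  then show ?thesis using that by (auto simp: length_Suc_conv)
qed

lemma many_preds:
  assumes "large_gate g" "preds g = js"
  obtains a b c js' where "js = a # b # c # js'"
proof -
  have "Suc (Suc (Suc 0)) \<le> length js" using assms by (simp add: large_gate_def)
  then show ?thesis using that by (auto simp: Suc_le_length_iff)
qed

locale circuit_valuation =
  fixes G :: circuit and v :: "nat \<Rightarrow> bool"
  assumes wf: "wf_circuit G" and valuation: "valuation G v"
begin

lemma gate_ok: "j < length G \<Longrightarrow> gate_ok v j (G ! j)"
  using valuation by (simp add: valuation_def)

lemma arity: "j < length G \<Longrightarrow> G ! j = AndGate js \<or> G ! j = OrGate js \<Longrightarrow> 2 \<le> length js"
  using wf unfolding wf_circuit_def by blast

text \<open>The demanded value \<open>p\<close> is pushed towards the inputs as in De Morgan's laws.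
  Conjunctive gates join clause lists; disjunctive ones have two predecessors here and are
  distributed.\<close>

lemma sat_gate_cnf:
  "small_below G f j \<Longrightarrow> sat_cnf v (gate_cnf f (enumerate 0 G) p j) \<longleftrightarrow> v j = p"
proof (induction f arbitrary: p j)
  case (Suc f)
  then have j: "j < length G" and small: "\<not> large_gate (G ! j)"
    and IH: "\<And>i p. i \<in> set (preds (G ! j)) \<Longrightarrow>
      sat_cnf v (gate_cnf f (enumerate 0 G) p i) \<longleftrightarrow> v i = p"
    by auto
  note ok = gate_ok[OF j] and [simp] = concat_map_enumerate0[OF j]
  show ?case
  proof (cases "G ! j")
    case Input
    then show ?thesis by (simp add: sat_cnf_def sat_clause_def)
  next
    case (NotGate i)
    then show ?thesis using ok IH[of i] by auto
  next
    case (AndGate js)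
    obtain a b where "js = [a, b]"
      using two_preds[OF arity[OF j] small] AndGate by auto
    then show ?thesis
      using ok IH AndGate by (cases p) (auto simp: sat_cnf_product sat_cnf_append)
  next
    case (OrGate js)
    obtain a b where "js = [a, b]"
      using two_preds[OF arity[OF j] small] OrGate by auto
    then show ?thesis
      using ok IH OrGate by (cases p) (auto simp: sat_cnf_product sat_cnf_append)
  qed
qed simp

text \<open>Distributing a large conjunctive gate would be exponential, but nothing large lies below
  it: its predecessors have clause forms, which together make one disjunct. A large disjunctive gate
  merely collects disjuncts.\<close>

lemma sat_gate_dnf:
  "weft1_below G f j \<Longrightarrow> (\<exists>w\<in>set (gate_dnf f (enumerate 0 G) p j). sat_cnf v w) \<longleftrightarrow> v j = p"
proof (induction f arbitrary: p j)
  case (Suc f)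
  have j: "j < length G" using Suc.prems by simp
  have IH: "(\<exists>w\<in>set (gate_dnf f (enumerate 0 G) p i). sat_cnf v w) \<longleftrightarrow> v i = p"
    if "i \<in> set (preds (G ! j))" for i p
  proof (rule Suc.IH)
    show "weft1_below G f i" using that Suc.prems small_imp_weft1 by (auto split: if_splits)
  qed
  have IHc: "sat_cnf v (gate_cnf f (enumerate 0 G) p i) \<longleftrightarrow> v i = p"
    if "i \<in> set (preds (G ! j))" "large_gate (G ! j)" for i p
    using that Suc.prems sat_gate_cnf by auto
  note ok = gate_ok[OF j] and [simp] = concat_map_enumerate0[OF j]
  \<comment> \<open>Treats a true conjunction and a false disjunction at once;
    \<open>or_like\<close> treats the two dual cases.\<close>
  have and_like: ?case
    if js: "preds (G ! j) = js" "2 \<le> length js" and k: "gate_kind (G ! j) \<noteq> 0" "gate_kind (G ! j) \<noteq> 1"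
      "(gate_kind (G ! j) = 2) = p" and sem: "v j = p \<longleftrightarrow> (\<forall>i\<in>set js. v i = p)" for js
  proof (cases "large_gate (G ! j)")
    case True
    obtain a b c js' where "js = a # b # c # js'" using many_preds[OF True js(1)] by blast
    then have "gate_dnf (Suc f) (enumerate 0 G) p j =
        [concat (map (\<lambda>i. gate_cnf f (enumerate 0 G) p i) js)]"
      using js k by simp
    then show ?thesis using IHc True js(1) sem by (auto simp: sat_cnf_concat_map)
  next
    case False
    obtain a b where ab: "js = [a, b]" using two_preds[OF js(2) False js(1)] by blast
    then have "gate_dnf (Suc f) (enumerate 0 G) p j =
        concat (map (\<lambda>w. map (\<lambda>w'. w @ w') (gate_dnf f (enumerate 0 G) p b))
          (gate_dnf f (enumerate 0 G) p a))"
      using js k by simp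
    then show ?thesis using IH[of a p] IH[of b p] js(1) ab sem by (auto simp: sat_cnf_append)
  qed
  have or_like: ?case
    if js: "preds (G ! j) = js" and k: "gate_kind (G ! j) \<noteq> 0" "gate_kind (G ! j) \<noteq> 1"
      "(gate_kind (G ! j) = 2) \<noteq> p" and sem: "v j = p \<longleftrightarrow> (\<exists>i\<in>set js. v i = p)" for js
  proof -
    have "gate_dnf (Suc f) (enumerate 0 G) p j =
        concat (map (\<lambda>i. gate_dnf f (enumerate 0 G) p i) js)"
      using js k by simp
    then show ?thesis using IH js sem by auto
  qed
  show ?case
  proof (cases "G ! j")
    case Input
    then show ?thesis by (simp add: sat_cnf_def sat_clause_def)
  next
    case (NotGate i)
    then show ?thesis using ok IH[of i] by auto
  next
    case (AndGate js)
    then have "2 \<le> length js" using arity[OF j] by blast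
    then show ?thesis
      using AndGate ok by (cases p) (intro and_like or_like; simp; fail)+
  next
    case (OrGate js)
    then have "2 \<le> length js" using arity[OF j] by blast
    then show ?thesis
      using OrGate ok by (cases p) (intro and_like or_like; simp; fail)+
  qed
qed simp

end

section \<open>Length and variables of the clauses\<close>

lemma in_concat_map_enumerateE:
  assumes "y \<in> set (concat (map (\<lambda>z. if fst z \<noteq> j then [] else h (snd z)) N))"
  obtains g where "(j, g) \<in> set N" "y \<in> set (h g)"
  using assms by (auto split: if_splits)

lemma gate_cnf_SucE:
  assumes "c \<in> set (gate_cnf (Suc f) N p j)"
  obtains g where "c = [(j, p)]" "(j, g) \<in> set N" "gate_kind g = 0"
  | p' i where "c \<in> set (gate_cnf f N p' i)"
  | p' a b c1 c2 where "c = c1 @ c2" "c1 \<in> set (gate_cnf f N p' a)" "c2 \<in> set (gate_cnf f N p' b)"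
proof -
  obtain g where g: "(j, g) \<in> set N" "c \<in> set (if gate_kind g = 0 then [[(j, p)]]
     else if gate_kind g = 1 then concat (map (\<lambda>i. gate_cnf f N (\<not> p) i) (preds g))
     else if (gate_kind g = 2) = p then concat (map (\<lambda>i. gate_cnf f N p i) (preds g))
     else (case preds g of [] \<Rightarrow> [] | a # js \<Rightarrow> (case js of [] \<Rightarrow> [] | b # _ \<Rightarrow>
       concat (map (\<lambda>c. map (\<lambda>c'. c @ c') (gate_cnf f N p b)) (gate_cnf f N p a)))))"
    using assms unfolding gate_cnf.simps by (rule in_concat_map_enumerateE)
  show ?thesis
  proof (cases "gate_kind g = 0 \<or> gate_kind g = 1 \<or> (gate_kind g = 2) = p")
    case True
    with g that(1,2) show ?thesis by (auto split: if_splits)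
  next
    case False
    show ?thesis
    proof (cases "\<exists>a b js. preds g = a # b # js")
      case True
      with False g(2) show ?thesis by (auto intro: that(3))
    next
      case few: False
      with False g(2) show ?thesis by (cases "preds g"; cases "tl (preds g)") auto
    qed
  qed
qed

lemma gate_dnf_SucE:
  assumes "w \<in> set (gate_dnf (Suc f) N p j)"
  obtains g where "w = [[(j, p)]]" "(j, g) \<in> set N" "gate_kind g = 0"
  | p' i where "w \<in> set (gate_dnf f N p' i)"
  | p' a b w1 w2 where "w = w1 @ w2" "w1 \<in> set (gate_dnf f N p' a)" "w2 \<in> set (gate_dnf f N p' b)"
  | p' js where "w = concat (map (gate_cnf f N p') js)"
proof -
  obtain g where g: "(j, g) \<in> set N" "w \<in> set (if gate_kind g = 0 then [[[(j, p)]]]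
     else if gate_kind g = 1 then concat (map (\<lambda>i. gate_dnf f N (\<not> p) i) (preds g))
     else if (gate_kind g = 2) \<noteq> p then concat (map (\<lambda>i. gate_dnf f N p i) (preds g))
     else (case preds g of [] \<Rightarrow> [] | a # js \<Rightarrow> (case js of [] \<Rightarrow> [] | b # js' \<Rightarrow>
       (case js' of
         [] \<Rightarrow> concat (map (\<lambda>w. map (\<lambda>w'. w @ w') (gate_dnf f N p b)) (gate_dnf f N p a))
       | _ # _ \<Rightarrow> [concat (map (\<lambda>i. gate_cnf f N p i) (preds g))]))))"
    using assms unfolding gate_dnf.simps by (rule in_concat_map_enumerateE)
  show ?thesis
  proof (cases "gate_kind g = 0 \<or> gate_kind g = 1 \<or> (gate_kind g = 2) \<noteq> p")
    case True
    with g that(1,2) show ?thesis by (auto split: if_splits)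
  next
    case False
    consider "preds g = []" | a where "preds g = [a]" | a b where "preds g = [a, b]"
      | a b c js where "preds g = a # b # c # js"
      by (metis list.exhaust)
    then show ?thesis
    proof cases
      case 3
      with False g(2) show ?thesis by (auto intro: that(3))
    next
      case 4
      with False g(2) have "w = concat (map (gate_cnf f N p) (preds g))" by simp
      then show ?thesis by (rule that(4))
    qed (use False g(2) in auto)
  qed
qed

text \<open>Clauses grow only at a binary disjunctive gate, which joins two of them, so the length
  at most doubles per level.\<close>

lemma length_gate_cnf: "c \<in> set (gate_cnf f N p j) \<Longrightarrow> length c \<le> 2 ^ f"
proof (induction f arbitrary: p j c)
  case (Suc f)
  from Suc.prems show ?case
  proof (cases rule: gate_cnf_SucE)
    case (3 p' a b c1 c2)
    then have "length c1 \<le> 2 ^ f" "length c2 \<le> 2 ^ f" using Suc.IH by blast+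
    then show ?thesis using 3(1) by simp
  qed (use Suc.IH in fastforce)+
qed simp

lemma length_gate_dnf: "w \<in> set (gate_dnf f N p j) \<Longrightarrow> c \<in> set w \<Longrightarrow> length c \<le> 2 ^ f"
proof (induction f arbitrary: p j c w)
  case (Suc f)
  from Suc.prems(1) show ?case
    by (cases rule: gate_dnf_SucE) (use Suc.prems(2) in \<open>auto dest!: Suc.IH length_gate_cnf\<close>)
qed simp

lemma numbered_input: "(j, g) \<in> set (enumerate 0 G) \<Longrightarrow> gate_kind g = 0 \<Longrightarrow> j \<in> set (inputs G)"
  by (force simp: inputs_def)

lemma inputs_gate_cnf:
  "c \<in> set (gate_cnf f (enumerate 0 G) p j) \<Longrightarrow> l \<in> set c \<Longrightarrow> fst l \<in> set (inputs G)"
proof (induction f arbitrary: p j c)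
  case (Suc f)
  from Suc.prems(1) show ?case
    by (cases rule: gate_cnf_SucE) (use Suc.prems(2) Suc.IH numbered_input in auto)
qed simp

lemma inputs_gate_dnf:
  "w \<in> set (gate_dnf f (enumerate 0 G) p j) \<Longrightarrow> c \<in> set w \<Longrightarrow> l \<in> set c \<Longrightarrow> fst l \<in> set (inputs G)"
proof (induction f arbitrary: p j c w)
  case (Suc f)
  from Suc.prems(1) show ?case
  proof (cases rule: gate_dnf_SucE)
    case (4 p' js)
    then show ?thesis using Suc.prems(2,3) by (auto dest: inputs_gate_cnf)
  qed (use Suc.prems(2,3) Suc.IH numbered_input in auto)
qed simp

section \<open>Paths, depth and weft\<close>

definition path_to :: "circuit \<Rightarrow> nat \<Rightarrow> nat list \<Rightarrow> bool" where
  "path_to G j p \<longleftrightarrow> p \<noteq> [] \<and> (\<forall>i\<in>set p. i < length G) \<and> G ! hd p = Input \<and> last p = j \<and>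
     (\<forall>l. Suc l < length p \<longrightarrow> p ! l \<in> set (preds (G ! (p ! Suc l))))"

lemma path_to_snoc:
  assumes "path_to G i p" "i \<in> set (preds (G ! j))" "j < length G"
  shows "path_to G j (p @ [j])"
  unfolding path_to_def
proof (intro conjI allI impI)
  fix l assume l: "Suc l < length (p @ [j])"
  show "(p @ [j]) ! l \<in> set (preds (G ! ((p @ [j]) ! Suc l)))"
  proof (cases "Suc l < length p")
    case True
    then show ?thesis using assms(1) by (simp add: path_to_def nth_append)
  next
    case False
    then have "l = length p - 1" "p \<noteq> []" using l assms(1) by (auto simp: path_to_def)
    then show ?thesis using assms by (simp add: path_to_def nth_append last_conv_nth)
  qed
qed (use assms in \<open>auto simp: path_to_def\<close>)

lemma preds_less: "wf_circuit G \<Longrightarrow> j < length G \<Longrightarrow> i \<in> set (preds (G ! j)) \<Longrightarrow> i < j"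
  unfolding wf_circuit_def by blast

lemma no_preds:
  assumes "wf_circuit G" "j < length G" "preds (G ! j) = []"
  shows "G ! j = Input"
proof (cases "G ! j")
  case (AndGate js)
  then have "2 \<le> length js" using assms(1,2) unfolding wf_circuit_def by blast
  then show ?thesis using assms(3) AndGate by simp
next
  case (OrGate js)
  then have "2 \<le> length js" using assms(1,2) unfolding wf_circuit_def by blast
  then show ?thesis using assms(3) OrGate by simp
qed (use assms in auto)

lemma path_to_exists:
  assumes "wf_circuit G" "j < length G"
  shows "\<exists>p. path_to G j p"
  using assms(2)
proof (induction j rule: less_induct)
  case (less j)
  show ?case
  proof (cases "preds (G ! j)")
    case Nil
    then have "path_to G j [j]"
      using no_preds[OF assms(1) less.prems] less.prems by (simp add: path_to_def)
    then show ?thesis by blast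
  next
    case (Cons i js)
    then have i: "i \<in> set (preds (G ! j))" by simp
    have "i < j" using preds_less[OF assms(1) less.prems i] .
    with less obtain p where "path_to G i p" by fastforce
    from path_to_snoc[OF this i less.prems] show ?thesis by blast
  qed
qed

abbreviation "large_count G p \<equiv> length (filter (\<lambda>i. large_gate (G ! i)) p)"

lemma large_count_last: "path_to G j p \<Longrightarrow> large_gate (G ! j) \<Longrightarrow> 1 \<le> large_count G p"
  by (cases p rule: rev_cases) (auto simp: path_to_def)

text \<open>A failure of the recursion is traced back to a path that is too long or meets a large
  gate. If \<open>j\<close> itself is large, any path to \<open>j\<close> serves.\<close>

lemma not_small_below:
  assumes "wf_circuit G" "j < length G" "\<not> small_below G f j"
  shows "\<exists>p. path_to G j p \<and> (f < length p \<or> 1 \<le> large_count G p)"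
  using assms(2,3)
proof (induction f arbitrary: j)
  case 0
  then obtain p where "path_to G j p" using path_to_exists[OF assms(1)] by blast
  then show ?case by (auto simp: path_to_def)
next
  case (Suc f)
  show ?case
  proof (cases "large_gate (G ! j)")
    case True
    then show ?thesis using path_to_exists[OF assms(1) Suc.prems(1)] large_count_last by blast
  next
    case False
    then obtain i where i: "i \<in> set (preds (G ! j))" "\<not> small_below G f i" using Suc.prems by auto
    have "i < length G" using preds_less[OF assms(1) Suc.prems(1) i(1)] Suc.prems(1) by simp
    then obtain p where p: "path_to G i p" "f < length p \<or> 1 \<le> large_count G p"
      using Suc.IH i(2) by blast
    show ?thesis
      by (rule exI[of _ "p @ [j]"]) (use path_to_snoc[OF p(1) i(1) Suc.prems(1)] p(2) in auto)
  qed
qed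

text \<open>Below a large gate one further large gate suffices, since appending \<open>j\<close> to
  the path adds the second.\<close>

lemma not_weft1_below:
  assumes "wf_circuit G" "j < length G" "\<not> weft1_below G f j"
  shows "\<exists>p. path_to G j p \<and> (f < length p \<or> 2 \<le> large_count G p)"
  using assms(2,3)
proof (induction f arbitrary: j)
  case 0
  then obtain p where "path_to G j p" using path_to_exists[OF assms(1)] by blast
  then show ?case by (auto simp: path_to_def)
next
  case (Suc f)
  obtain i where i: "i \<in> set (preds (G ! j))"
    "if large_gate (G ! j) then \<not> small_below G f i else \<not> weft1_below G f i"
    using Suc.prems by (auto split: if_splits)
  have "i < length G" using preds_less[OF assms(1) Suc.prems(1) i(1)] Suc.prems(1) by simp
  then have "\<exists>p. path_to G i p \<and>
      (f < length p \<or> (if large_gate (G ! j) then 1 else 2) \<le> large_count G p)"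
    using Suc.IH i(2) not_small_below[OF assms(1)] by (auto split: if_splits)
  then obtain p where p: "path_to G i p"
      "f < length p \<or> (if large_gate (G ! j) then 1 else 2) \<le> large_count G p" by blast
  show ?case
    by (rule exI[of _ "p @ [j]"])
      (use path_to_snoc[OF p(1) i(1) Suc.prems(1)] p(2) in \<open>auto split: if_splits\<close>)
qed

text \<open>Depth counts edges but the recursion counts gates, hence \<open>Suc d\<close>.\<close>

lemma weft1_below_output:
  assumes "wf_circuit G" "weft_at_most G 1" "depth_at_most G d"
  shows "weft1_below G (Suc d) (length G - 1)"
proof (rule ccontr)
  assume n: "\<not> ?thesis"
  have "length G - 1 < length G" using assms(1) by (simp add: wf_circuit_def)
  from not_weft1_below[OF assms(1) this n] obtain p where
    p: "path_to G (length G - 1) p" "Suc d < length p \<or> 2 \<le> large_count G p" by blast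
  have "input_output_path G p" using p(1) unfolding path_to_def input_output_path_def by blast
  then have "length p - 1 \<le> d" "large_count G p \<le> 1"
    using assms(2,3) unfolding weft_at_most_def depth_at_most_def by blast+
  then show False using p(2) by linarith
qed

lemma valuation_exists:
  assumes "wf_circuit G"
  shows "\<exists>v. valuation G v \<and> (\<forall>i<length G. G ! i = Input \<longrightarrow> v i = (i \<in> S))"
proof -
  have "\<exists>v. (\<forall>i<n. gate_ok v i (G ! i) \<and> (G ! i = Input \<longrightarrow> v i = (i \<in> S)))"
    if "n \<le> length G" for n
    using that
  proof (induction n)
    case (Suc n)
    then obtain v where v: "\<And>i. i < n \<Longrightarrow> gate_ok v i (G ! i) \<and> (G ! i = Input \<longrightarrow> v i = (i \<in> S))"
      by fastforce
    have n: "n < length G" using Suc.prems by simp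
    let ?b = "case G ! n of Input \<Rightarrow> n \<in> S | NotGate j \<Rightarrow> \<not> v j
      | AndGate js \<Rightarrow> (\<forall>j\<in>set js. v j) | OrGate js \<Rightarrow> (\<exists>j\<in>set js. v j)"
    let ?v = "v(n := ?b)"
    have less: "j < i" if "i < Suc n" "j \<in> set (preds (G ! i))" for i j
      using preds_less[OF assms _ that(2)] that(1) n by simp
    have "gate_ok ?v i (G ! i) \<and> (G ! i = Input \<longrightarrow> ?v i = (i \<in> S))" if i: "i < Suc n" for i
    proof -
      have p: "?v j = v j" if "j \<in> set (preds (G ! i))" for j
        using less[OF i that] i by simp
      show ?thesis
      proof (cases "i = n")
        case True
        then show ?thesis using p by (cases "G ! n") auto
      next
        case False
        then have "i < n" using i by simp
        from v[OF this] show ?thesis using p False by (cases "G ! i") auto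
      qed
    qed
    then show ?case by blast
  qed simp
  from this[OF order_refl] show ?thesis unfolding valuation_def by blast
qed

lemma set_inputs: "set (inputs G) = {i. i < length G \<and> G ! i = Input}"
proof -
  have "gate_kind g = 0 \<longleftrightarrow> g = Input" for g by (cases g) auto
  then have "set (inputs G) = {j. \<exists>g. (j, g) \<in> set (enumerate 0 G) \<and> g = Input}"
    by (force simp: inputs_def)
  then show ?thesis by (auto simp: in_set_enumerate_eq)
qed

lemma output_dnf_eq:
  assumes "G \<noteq> []"
  shows "output_dnf f G = gate_dnf f (enumerate 0 G) True (length G - 1)"
proof -
  obtain G' g where "G = G' @ [g]" using assms by (cases G rule: rev_cases) auto
  then show ?thesis by (simp add: output_dnf_def enumerate_append_eq)
qed

lemma sat_clause_cong:
  "(\<And>l. l \<in> set c \<Longrightarrow> v (fst l) = v' (fst l)) \<Longrightarrow> sat_clause v c = sat_clause v' c"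
  by (auto simp: sat_clause_def)

text \<open>The clauses mention inputs only, so their truth depends on the selected set
  \<open>S\<close> and not on the values of inner gates.\<close>

lemma output_dnf_correct:
  assumes wf: "wf_circuit G" and weft: "weft_at_most G 1" and depth: "depth_at_most G d"
    and v: "valuation G v" and S: "\<And>i. i < length G \<Longrightarrow> G ! i = Input \<Longrightarrow> v i \<longleftrightarrow> i \<in> S"
  shows "(\<exists>w\<in>set (output_dnf (Suc d) G). sat_cnf (\<lambda>i. i \<in> S) w) \<longleftrightarrow> v (length G - 1)"
proof -
  interpret circuit_valuation G v using wf v by unfold_locales
  have "G \<noteq> []" using wf by (simp add: wf_circuit_def)
  note out = output_dnf_eq[OF this, of "Suc d"]
  have "sat_cnf (\<lambda>i. i \<in> S) w \<longleftrightarrow> sat_cnf v w" if w: "w \<in> set (output_dnf (Suc d) G)" for w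
  proof -
    have "v (fst l) \<longleftrightarrow> fst l \<in> S" if "c \<in> set w" "l \<in> set c" for c l
      using inputs_gate_dnf[OF w[unfolded out] that] S by (simp add: set_inputs)
    then show ?thesis unfolding sat_cnf_def by (metis sat_clause_cong)
  qed
  then show ?thesis
    using sat_gate_dnf[OF weft1_below_output[OF wf weft depth], of True] by (simp add: out)
qed

lemma weighted_satisfiable_iff:
  assumes wf: "wf_circuit G" and weft: "weft_at_most G 1" and depth: "depth_at_most G d"
  shows "weighted_satisfiable G k \<longleftrightarrow> (\<exists>a. inj_on a {..<k} \<and> a ` {..<k} \<subseteq> set (inputs G) \<and>
    (\<exists>w\<in>set (output_dnf (Suc d) G). sat_cnf (\<lambda>i. i \<in> a ` {..<k}) w))"
proof
  assume "weighted_satisfiable G k"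
  then obtain v where v: "valuation G v" "v (length G - 1)" "weight G v = k"
    unfolding weighted_satisfiable_def by blast
  let ?S = "{i. i < length G \<and> G ! i = Input \<and> v i}"
  have "finite ?S" "card ?S = k" using v(3) by (simp_all add: weight_def)
  then obtain a where a: "bij_betw a {..<k} ?S"
    using ex_bij_betw_nat_finite by (metis atLeast0LessThan)
  then have S: "a ` {..<k} = ?S" by (simp add: bij_betw_def)
  have "\<exists>w\<in>set (output_dnf (Suc d) G). sat_cnf (\<lambda>i. i \<in> ?S) w"
    using output_dnf_correct[OF wf weft depth v(1), of ?S] v(2) by blast
  then show "\<exists>a. inj_on a {..<k} \<and> a ` {..<k} \<subseteq> set (inputs G) \<and>
    (\<exists>w\<in>set (output_dnf (Suc d) G). sat_cnf (\<lambda>i. i \<in> a ` {..<k}) w)"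
    using a S by (intro exI[of _ a]) (auto simp: bij_betw_def set_inputs)
next
  assume "\<exists>a. inj_on a {..<k} \<and> a ` {..<k} \<subseteq> set (inputs G) \<and>
    (\<exists>w\<in>set (output_dnf (Suc d) G). sat_cnf (\<lambda>i. i \<in> a ` {..<k}) w)"
  then obtain a where a: "inj_on a {..<k}" "a ` {..<k} \<subseteq> set (inputs G)"
    "\<exists>w\<in>set (output_dnf (Suc d) G). sat_cnf (\<lambda>i. i \<in> a ` {..<k}) w" by blast
  let ?S = "a ` {..<k}"
  obtain v where v: "valuation G v" "\<And>i. i < length G \<Longrightarrow> G ! i = Input \<Longrightarrow> v i = (i \<in> ?S)"
    using valuation_exists[OF wf, of ?S] by blast
  have "v (length G - 1)" using output_dnf_correct[OF wf weft depth v] a(3) by blast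
  moreover have "{i. i < length G \<and> G ! i = Input \<and> v i} = ?S"
    using v(2) a(2) by (auto simp: set_inputs)
  then have "weight G v = k" using a(1) by (simp add: weight_def card_image)
  ultimately show "weighted_satisfiable G k" using v(1) unfolding weighted_satisfiable_def by blast
qed

section \<open>Correctness of the reduction\<close>

lemma length_filter_concat_map:
  "length (filter P (concat (map h xs))) = sum_list (map (\<lambda>x. length (filter P (h x))) xs)"
  by (induction xs) auto

lemma length_filter_map_const: "length (filter P (map (\<lambda>_. c) xs)) = (if P c then length xs else 0)"
  by (induction xs) auto

lemma sum_list_at_most_one:
  assumes "\<And>x. x \<in> set xs \<Longrightarrow> b x \<le> (1::nat)"
  shows "sum_list (map b xs) \<le> length xs"
    and "length xs \<le> sum_list (map b xs) \<longleftrightarrow> (\<forall>x\<in>set xs. b x = 1)"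
proof -
  have "sum_list (map b xs) \<le> length xs \<and>
      (length xs \<le> sum_list (map b xs) \<longleftrightarrow> (\<forall>x\<in>set xs. b x = 1))"
    using assms
  proof (induction xs)
    case (Cons x xs)
    have IH: "sum_list (map b xs) \<le> length xs"
      "length xs \<le> sum_list (map b xs) \<longleftrightarrow> (\<forall>x\<in>set xs. b x = 1)"
      using Cons by simp_all
    moreover have "b x \<le> 1" using Cons.prems by simp
    ultimately have "Suc (length xs) \<le> b x + sum_list (map b xs) \<longleftrightarrow>
        b x = 1 \<and> length xs \<le> sum_list (map b xs)" "b x + sum_list (map b xs) \<le> Suc (length xs)"
      by linarith+
    then show ?case using IH(2) by simp
  qed simp
  then show "sum_list (map b xs) \<le> length xs"
    and "length xs \<le> sum_list (map b xs) \<longleftrightarrow> (\<forall>x\<in>set xs. b x = 1)" by blast+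
qed

text \<open>The vectors passing the test number the product, over the literals, of the statuses
  passing it, and each factor is at most one.\<close>

lemma length_filter_statuses:
  assumes "\<And>x. length (filter (\<lambda>r. Q (x, r)) R) \<le> 1"
  shows "length (filter (list_all Q) (statuses f R c)) \<le> 1"
proof (induction f arbitrary: c)
  case (Suc f)
  have sum_if: "sum_list (map (\<lambda>r. if P r then n else 0) rs) = length (filter P rs) * n"
    for P and n :: nat and rs :: "nat list"
    by (induction rs) auto
  show ?case
  proof (cases c)
    case (Cons x ls)
    let ?n = "length (filter (list_all Q) (statuses f R ls))"
    have "length (filter (list_all Q) (map (\<lambda>e. (x, r) # e) (statuses f R ls))) =
        (if Q (x, r) then ?n else 0)" for r
      by (simp add: filter_map comp_def)
    then have "length (filter (list_all Q) (statuses (Suc f) R c)) =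
        sum_list (map (\<lambda>r. if Q (x, r) then ?n else 0) R)"
      by (simp add: Cons length_filter_concat_map)
    also have "\<dots> = length (filter (\<lambda>r. Q (x, r)) R) * ?n"
      using sum_if[of "\<lambda>r. Q (x, r)" ?n R] .
    also have "\<dots> \<le> 1 * 1" by (intro mult_le_mono assms Suc.IH)
    finally show ?thesis by simp
  qed simp
qed simp

lemma set_statuses:
  "length c \<le> f \<Longrightarrow> e \<in> set (statuses f R c) \<longleftrightarrow> map fst e = c \<and> snd ` set e \<subseteq> set R"
proof (induction f arbitrary: c e)
  case (Suc f)
  show ?case
  proof (cases c)
    case (Cons x ls)
    then show ?thesis using Suc by (cases e) (auto simp: image_iff)
  qed auto
qed auto

text \<open>One entry per clause occurrence, labelled with its disjunct: the units that yield at
  most one survivor each.\<close>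

definition clause_blocks :: "clause list list \<Rightarrow> (nat \<times> clause) list" where
  "clause_blocks W = concat (map (\<lambda>z. map (Pair (fst z)) (snd z)) (enumerate 1 W))"

lemma length_clause_blocks: "length (clause_blocks W) = length (concat W)"
proof -
  have "length (concat (map (\<lambda>z. map (Pair (fst z)) (snd z)) L)) = length (concat (map snd L))"
    for L :: "(nat \<times> clause list) list"
    by (induction L) auto
  from this[of "enumerate 1 W"] show ?thesis by (simp add: clause_blocks_def)
qed

lemma set_clause_blocks:
  "set (clause_blocks W) = {(w, cl). 1 \<le> w \<and> w \<le> length W \<and> cl \<in> set (W ! (w - 1))}"
proof -
  have "set (clause_blocks W) = {(w, cl). \<exists>ws. (w, ws) \<in> set (enumerate 1 W) \<and> cl \<in> set ws}"
    by (auto simp: clause_blocks_def)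
  then show ?thesis by (auto simp: in_set_enumerate_eq)
qed

lemma guess_items_blocks: "guess_items f R k W = concat (map (\<lambda>(w, cl).
    (w, False, []) # map (\<lambda>e. (w, True, e)) (clause_items f R k cl)) (clause_blocks W))"
proof -
  have "concat (map (\<lambda>z. concat (map (\<lambda>cl. h (fst z) cl) (snd z))) L) =
      concat (map (\<lambda>(w, cl). h w cl) (concat (map (\<lambda>z. map (Pair (fst z)) (snd z)) L)))"
    for h :: "nat \<Rightarrow> clause \<Rightarrow> item list" and L
    by (induction L) (auto simp: comp_def)
  then show ?thesis unfolding guess_items_def clause_blocks_def .
qed

text \<open>\<open>g\<close> is the guessed disjunct, counted from 1, and \<open>a i\<close> the
  input selected by slot \<open>i\<close>. The map \<open>a\<close> may repeat inputs; ruling that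
  out is left to the tautologies.\<close>

locale selection =
  fixes f k :: nat and W :: "clause list list" and g :: nat and a :: "nat \<Rightarrow> nat"
  assumes g: "1 \<le> g" "g \<le> length W"
    and clause_length: "\<And>w cl. w \<in> set W \<Longrightarrow> cl \<in> set w \<Longrightarrow> length cl \<le> f"
begin

definition "fits l \<longleftrightarrow> (\<forall>i<k. (fst (fst l) = a i) = (snd l = i))" for l :: "(nat \<times> bool) \<times> nat"

definition "survives it \<longleftrightarrow> \<not> guess_kills g it \<and> (\<forall>i<k. \<not> slot_kills i (a i) it)"

definition "fitting cl = length (filter (list_all fits) (clause_items f [0..<k] k cl))"

lemma survives_real: "1 \<le> w \<Longrightarrow> survives (w, True, e) \<longleftrightarrow> w = g \<and> list_all fits e"
  by (auto simp: survives_def guess_kills_def slot_kills_def fits_def list_all_iff list_ex_iff)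

lemma survives_pad: "1 \<le> w \<Longrightarrow> survives (w, False, []) \<longleftrightarrow> w \<noteq> g"
  by (auto simp: survives_def guess_kills_def slot_kills_def)

lemma survives_dummies: "\<not> survives (0, True, [])" "survives (0, False, [])"
  using g by (auto simp: survives_def guess_kills_def slot_kills_def)

text \<open>If a status \<open>r < k\<close> fits a literal, its input is \<open>a r\<close>, and
  then every fitting status must equal \<open>r\<close>. Otherwise only the status \<open>k\<close>
  remains.\<close>

lemma fitting_le_1: "fitting cl \<le> 1"
proof -
  have "length (filter (\<lambda>r. fits (x, r)) (k # [0..<k])) \<le> 1" for x
  proof -
    have "r = r'" if "r \<in> set (k # [0..<k])" "fits (x, r)" "r' \<in> set (k # [0..<k])" "fits (x, r')"
      for r r'
    proof (cases "r = k \<and> r' = k")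
      case False
      then have "r < k \<or> r' < k" using that by auto
      then show ?thesis using that by (auto simp: fits_def)
    qed simp
    moreover have "distinct (k # [0..<k])" by simp
    ultimately have "card {r. fits (x, r) \<and> r \<in> set (k # [0..<k])} \<le> Suc 0"
      by (subst card_le_Suc0_iff_eq) auto
    then show ?thesis
      using distinct_length_filter[OF \<open>distinct (k # [0..<k])\<close>, of "\<lambda>r. fits (x, r)"]
      by (simp only: Int_def mem_Collect_eq One_nat_def)
  qed
  from length_filter_statuses[of fits, OF this]
  have "length (filter (list_all fits) (statuses f (k # [0..<k]) cl)) \<le> 1" .
  moreover have "fitting cl \<le> length (filter (list_all fits) (statuses f (k # [0..<k]) cl))"
    unfolding fitting_def clause_items_def filter_filter conj_commute[of "list_ex _ _"]
    by (simp only: filter_filter[symmetric] length_filter_le)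
  ultimately show ?thesis by linarith
qed

lemma fitting_iff: "fitting cl = 1 \<longleftrightarrow> (\<exists>e\<in>set (clause_items f [0..<k] k cl). list_all fits e)"
proof -
  have "fitting cl \<noteq> 0 \<longleftrightarrow> (\<exists>e\<in>set (clause_items f [0..<k] k cl). list_all fits e)"
    by (auto simp: fitting_def filter_empty_conv)
  then show ?thesis using fitting_le_1[of cl] by linarith
qed

lemma fits_status:
  assumes "fits z" "snd z \<in> set (k # [0..<k])"
  shows "snd z \<noteq> k \<longleftrightarrow> fst (fst z) \<in> a ` {..<k}"
  using assms by (auto simp: fits_def)

lemma fitting_sound:
  assumes "fitting cl = 1" "length cl \<le> f"
  shows "sat_clause (\<lambda>i. i \<in> a ` {..<k}) cl"
    and "l \<in> set cl \<Longrightarrow> i < k \<Longrightarrow> j < k \<Longrightarrow> a i = fst l \<Longrightarrow> a j = fst l \<Longrightarrow> i = j"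
proof -
  obtain e where e: "e \<in> set (statuses f (k # [0..<k]) cl)" "list_all fits e"
    "list_ex (\<lambda>z. (snd z \<noteq> k) = snd (fst z)) e"
    using assms(1) unfolding fitting_iff clause_items_def by auto
  have m: "map fst e = cl" "\<And>z. z \<in> set e \<Longrightarrow> snd z \<in> set (k # [0..<k])"
    using e(1) set_statuses[OF assms(2)] by auto
  have fits: "fits z" if "z \<in> set e" for z using e(2) that by (simp add: list_all_iff)
  obtain z where z: "z \<in> set e" "(snd z \<noteq> k) = snd (fst z)"
    using e(3) by (auto simp: list_ex_iff)
  then have "fst z \<in> set cl" "(fst (fst z) \<in> a ` {..<k}) = snd (fst z)"
    using m fits_status[OF fits m(2)] by auto
  then show "sat_clause (\<lambda>i. i \<in> a ` {..<k}) cl" unfolding sat_clause_def by blast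
  show "i = j" if l: "l \<in> set cl" and ij: "i < k" "j < k" "a i = fst l" "a j = fst l"
  proof -
    obtain z where "z \<in> set e" "fst z = l" using l m(1) by auto
    then have "snd z = i" "snd z = j"
      using fits[of z] ij unfolding fits_def by metis+
    then show ?thesis by simp
  qed
qed

lemma fitting_complete:
  assumes inj: "inj_on a {..<k}" and len: "length cl \<le> f"
    and sat: "sat_clause (\<lambda>i. i \<in> a ` {..<k}) cl"
  shows "fitting cl = 1"
proof -
  \<comment> \<open>The only vector that can survive: the slot selecting the input, or
    \<open>k\<close> if there is none. By injectivity this slot is unique.\<close>
  define st where "st x = (if x \<in> a ` {..<k} then inv_into {..<k} a x else k)" for x
  have st: "st x \<noteq> k \<longleftrightarrow> x \<in> a ` {..<k}" and st_less: "st x < k \<longleftrightarrow> st x \<noteq> k" for x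
    using inv_into_into[of x a "{..<k}"] by (auto simp: st_def)
  have fits: "fits (l, st (fst l))" for l
    using f_inv_into_f[of "fst l" a "{..<k}"] inv_into_f_f[OF inj]
    by (auto simp: fits_def st_def dest: inj_onD[OF inj])
  let ?e = "map (\<lambda>l. (l, st (fst l))) cl"
  have "?e \<in> set (statuses f (k # [0..<k]) cl)"
    using st_less by (auto simp: set_statuses[OF len] comp_def)
  moreover have "list_ex (\<lambda>z. (snd z \<noteq> k) = snd (fst z)) ?e"
    using sat st by (auto simp: sat_clause_def list_ex_iff)
  ultimately have "?e \<in> set (clause_items f [0..<k] k cl)" by (simp add: clause_items_def)
  moreover have "list_all fits ?e" using fits by (simp add: list_all_iff)
  ultimately show ?thesis unfolding fitting_iff by blast
qed

text \<open>Each clause outside disjunct \<open>g\<close> contributes exactly its additional item,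
  each clause of \<open>g\<close> its \<open>fitting\<close> count. The total reaches the number of
  clauses only if no contribution is 0.\<close>

lemma surviving_count:
  "length (concat W) \<le> length (filter survives (guess_items f [0..<k] k W)) \<longleftrightarrow>
     (\<forall>cl\<in>set (W ! (g - 1)). fitting cl = 1)"
  and surviving_le: "length (filter survives (guess_items f [0..<k] k W)) \<le> length (concat W)"
proof -
  define b where "b = (\<lambda>(w, cl). length (filter survives
    ((w, False, []) # map (\<lambda>e. (w, True, e)) (clause_items f [0..<k] k cl))))"
  have b: "b (w, cl) = (if w = g then fitting cl else 1)" if "(w, cl) \<in> set (clause_blocks W)" for w cl
    using that
    by (auto simp: b_def set_clause_blocks survives_pad survives_real filter_map comp_def fitting_def)
  have le: "b z \<le> 1" if "z \<in> set (clause_blocks W)" for z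
    using b fitting_le_1 that by (cases z) auto
  have eq: "length (filter survives (guess_items f [0..<k] k W)) =
      sum_list (map b (clause_blocks W))"
    unfolding guess_items_blocks length_filter_concat_map b_def
    by (rule arg_cong[where f = sum_list]) (auto split: prod.splits)
  show "length (filter survives (guess_items f [0..<k] k W)) \<le> length (concat W)"
    using sum_list_at_most_one(1)[of "clause_blocks W" b, OF le] by (simp only: eq length_clause_blocks[symmetric])
  have "(\<forall>z\<in>set (clause_blocks W). b z = 1) \<longleftrightarrow> (\<forall>cl\<in>set (W ! (g - 1)). fitting cl = 1)"
  proof
    show "\<forall>cl\<in>set (W ! (g - 1)). fitting cl = 1" if all: "\<forall>z\<in>set (clause_blocks W). b z = 1"
    proof
      fix cl assume "cl \<in> set (W ! (g - 1))"
      then have "(g, cl) \<in> set (clause_blocks W)" using g by (simp add: set_clause_blocks)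
      with all b[OF this] show "fitting cl = 1" by auto
    qed
    show "\<forall>z\<in>set (clause_blocks W). b z = 1" if "\<forall>cl\<in>set (W ! (g - 1)). fitting cl = 1"
      using that by (auto simp: b) (auto simp: set_clause_blocks)
  qed
  then show "length (concat W) \<le> length (filter survives (guess_items f [0..<k] k W)) \<longleftrightarrow>
     (\<forall>cl\<in>set (W ! (g - 1)). fitting cl = 1)"
    using sum_list_at_most_one(2)[of "clause_blocks W" b, OF le] by (simp only: eq length_clause_blocks[symmetric])
qed

text \<open>With \<open>s\<close> survivors among \<open>E\<close> guess items and \<open>c\<close>
  clauses, \<open>(E - s) + (k+1) + 2c <= E + (k+1) + c\<close> means \<open>c <= s\<close>.\<close>

lemma killed_count:
  "length (filter (\<lambda>it. \<not> survives it) (all_items f [0..<k] k W)) \<le>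
     length (capacity_list f [0..<k] k W) \<longleftrightarrow> (\<forall>cl\<in>set (W ! (g - 1)). fitting cl = 1)"
proof -
  let ?E = "guess_items f [0..<k] k W"
  have "length (filter (\<lambda>it. \<not> survives it) (all_items f [0..<k] k W)) =
      length (filter (\<lambda>it. \<not> survives it) ?E) + Suc k + 2 * length (concat W)"
    by (simp add: all_items_def length_filter_map_const survives_dummies del: length_concat)
  moreover have "length (filter survives ?E) + length (filter (\<lambda>it. \<not> survives it) ?E) = length ?E"
    by (rule sum_length_filter_compl)
  moreover have "length (capacity_list f [0..<k] k W) = length ?E + Suc k + length (concat W)"
    by (simp add: capacity_list_def)
  ultimately show ?thesis using surviving_count surviving_le by linarith
qed

end


lemma length_families: "length (families n ins W) = Suc n" by (simp add: families_def)

lemma families_0: "families n ins W ! 0 = map guess_kills (map fst (enumerate 1 W))"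
  by (simp add: families_def)

lemma families_Suc: "i < n \<Longrightarrow> families n ins W ! Suc i = map (slot_kills i) ins"
  by (simp add: families_def)

lemma guess_labels: "set (map fst (enumerate 1 W)) = {1..length W}"
  by (auto simp del: map_map)

text \<open>Translates choices of predicates into data: family 0 yields the disjunct
  \<open>g\<close>, family \<open>Suc i\<close> the input \<open>a i\<close>.\<close>

lemma families_choice_iff:
  fixes k :: nat and ins :: "nat list" and W :: "clause list list"
  assumes "\<And>w cl. w \<in> set W \<Longrightarrow> cl \<in> set w \<Longrightarrow> length cl \<le> f"
  defines "F \<equiv> families k ins W"
  shows "(\<exists>ch. (\<forall>i<length F. ch i \<in> set (F ! i)) \<and>
      length (filter (\<lambda>it. \<exists>i<length F. ch i it) (all_items f [0..<k] k W)) \<le>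
        length (capacity_list f [0..<k] k W)) \<longleftrightarrow>
    (\<exists>g a. 1 \<le> g \<and> g \<le> length W \<and> a ` {..<k} \<subseteq> set ins \<and>
      (\<forall>cl\<in>set (W ! (g - 1)). selection.fitting f k a cl = 1))" (is "?L \<longleftrightarrow> ?R")
proof -
  have sel: "selection f W g" if "1 \<le> g" "g \<le> length W" for g
    using that assms(1) by unfold_locales auto
  have count: "length (filter (\<lambda>it. \<exists>i<length F. ch i it) (all_items f [0..<k] k W)) \<le>
        length (capacity_list f [0..<k] k W) \<longleftrightarrow>
      (\<forall>cl\<in>set (W ! (g - 1)). selection.fitting f k a cl = 1)"
    if ch: "ch 0 = guess_kills g" "\<And>i. i < k \<Longrightarrow> ch (Suc i) = slot_kills i (a i)"
      and g: "1 \<le> g" "g \<le> length W" for ch g a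
  proof -
    have "(\<exists>i<length F. ch i it) \<longleftrightarrow> \<not> selection.survives k g a it" for it
      using ch by (auto simp: F_def length_families selection.survives_def[OF sel[OF g]] less_Suc_eq_0_disj)
    then show ?thesis using selection.killed_count[OF sel[OF g], of k a] by simp
  qed
  show ?thesis
  proof
    assume ?L
    then obtain ch where ch: "\<And>i. i < Suc k \<Longrightarrow> ch i \<in> set (F ! i)"
      "length (filter (\<lambda>it. \<exists>i<length F. ch i it) (all_items f [0..<k] k W)) \<le>
        length (capacity_list f [0..<k] k W)"
      by (auto simp: F_def length_families)
    have "ch 0 \<in> guess_kills ` {1..length W}"
      using ch(1)[of 0] by (simp only: F_def families_0 set_map[of guess_kills] guess_labels)
    then obtain g where g: "ch 0 = guess_kills g" "1 \<le> g" "g \<le> length W" by auto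
    have "\<exists>x. x \<in> set ins \<and> ch (Suc i) = slot_kills i x" if "i < k" for i
      using ch(1)[of "Suc i"] that by (auto simp: F_def families_Suc)
    then obtain a where a: "\<And>i. i < k \<Longrightarrow> a i \<in> set ins \<and> ch (Suc i) = slot_kills i (a i)"
      by metis
    have "\<forall>cl\<in>set (W ! (g - 1)). selection.fitting f k a cl = 1"
      using count[of ch g a] ch(2) g a by blast
    moreover have "a ` {..<k} \<subseteq> set ins" using a by auto
    ultimately show ?R using g(2,3) by blast
  next
    assume ?R
    then obtain g a where ga: "1 \<le> g" "g \<le> length W" "a ` {..<k} \<subseteq> set ins"
      "\<forall>cl\<in>set (W ! (g - 1)). selection.fitting f k a cl = 1" by blast
    define ch where "ch i = (case i of 0 \<Rightarrow> guess_kills g | Suc i \<Rightarrow> slot_kills i (a i))" for i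
    have "ch i \<in> set (F ! i)" if "i < length F" for i
    proof (cases i)
      case 0
      have "guess_kills g \<in> guess_kills ` {1..length W}" using ga(1,2) by simp
      then show ?thesis
        using 0 by (simp only: F_def families_0 set_map[of guess_kills] guess_labels)
          (simp add: ch_def)
    next
      case (Suc j)
      then have "j < k" using that by (simp add: F_def length_families)
      then show ?thesis using Suc ga(3) by (auto simp: F_def families_Suc ch_def)
    qed
    moreover have "length (filter (\<lambda>it. \<exists>i<length F. ch i it) (all_items f [0..<k] k W)) \<le>
        length (capacity_list f [0..<k] k W)"
      using count[of ch g a] ga by (simp add: ch_def)
    ultimately show ?L by blast
  qed
qed

lemma slots_eq: "k \<le> length G \<Longrightarrow> slots k G = [0..<k]"
proof -
  assume "k \<le> length G"
  then have "[0..<Suc (length G)] = [0..<k] @ k # [Suc k..<Suc (length G)]"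
    using upt_add_eq_append[of 0 k "Suc (length G) - k"] upt_conv_Cons[of k "Suc (length G)"] by simp
  then show ?thesis
    unfolding slots_def map_fst_enumerate by (simp add: takeWhile_append del: upt_Suc)
qed

lemma guesses_choice_iff:
  assumes wf: "wf_circuit G" and weft: "weft_at_most G 1" and depth: "depth_at_most G d"
  defines "W \<equiv> guesses (Suc d) G"
  shows "(\<exists>g a. 1 \<le> g \<and> g \<le> length W \<and> a ` {..<k} \<subseteq> set (inputs G) \<and>
      (\<forall>cl\<in>set (W ! (g - 1)). selection.fitting (2 ^ Suc d) k a cl = 1)) \<longleftrightarrow>
    weighted_satisfiable G k"
    and "\<And>w cl. w \<in> set W \<Longrightarrow> cl \<in> set w \<Longrightarrow> length cl \<le> 2 ^ Suc d"
proof -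
  let ?triv = "map (\<lambda>x. [(x, True), (x, False)]) (inputs G)"
  have W: "W = map (\<lambda>w. w @ ?triv) ([[]] # output_dnf (Suc d) G)"
    by (simp add: W_def guesses_def)
  have "G \<noteq> []" using wf by (simp add: wf_circuit_def)
  note out = output_dnf_eq[OF this, of "Suc d"]
  have mem: "\<exists>w0. w = w0 @ ?triv \<and> (w0 = [[]] \<or> w0 \<in> set (output_dnf (Suc d) G))"
    if "w \<in> set W" for w
    using that by (auto simp: W)
  show len: "length cl \<le> 2 ^ Suc d" if w: "w \<in> set W" and cl: "cl \<in> set w" for w cl
  proof -
    obtain w0 where w0: "w = w0 @ ?triv" "w0 = [[]] \<or> w0 \<in> set (output_dnf (Suc d) G)"
      using mem[OF w] by blast
    have "length cl \<le> 2 ^ Suc d" if "cl \<in> set w0"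
      using w0(2)
    proof
      assume "w0 \<in> set (output_dnf (Suc d) G)"
      then show ?thesis using length_gate_dnf that unfolding out by blast
    qed (use that in simp)
    \<comment> \<open>The tautologies have length 2, which fits the clause bound even at depth
      0.\<close>
    moreover have "Suc (Suc 0) \<le> 2 * 2 ^ d" using one_le_power[of "2 :: nat" d] by linarith
    ultimately show ?thesis using cl w0(1) by auto
  qed
  have sel: "selection (2 ^ Suc d) W g" if "1 \<le> g" "g \<le> length W" for g
    using that len by unfold_locales auto
  show "(\<exists>g a. 1 \<le> g \<and> g \<le> length W \<and> a ` {..<k} \<subseteq> set (inputs G) \<and>
      (\<forall>cl\<in>set (W ! (g - 1)). selection.fitting (2 ^ Suc d) k a cl = 1)) \<longleftrightarrow>
    weighted_satisfiable G k" (is "?L \<longleftrightarrow> _")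
  proof
    assume ?L
    then obtain g a where ga: "1 \<le> g" "g \<le> length W" "a ` {..<k} \<subseteq> set (inputs G)"
      and fit_all: "\<forall>cl\<in>set (W ! (g - 1)). selection.fitting (2 ^ Suc d) k a cl = 1"
      by (elim exE conjE)
    note fit = bspec[OF fit_all]
    interpret selection "2 ^ Suc d" k W g a using sel[OF ga(1,2)] .
    have gW: "W ! (g - 1) \<in> set W" using ga(1,2) by simp
    then obtain w0 where w0: "W ! (g - 1) = w0 @ ?triv"
      "w0 = [[]] \<or> w0 \<in> set (output_dnf (Suc d) G)" using mem[OF gW] by blast
    have sat: "sat_cnf (\<lambda>i. i \<in> a ` {..<k}) w0"
      unfolding sat_cnf_def using fitting_sound(1) fit len[OF gW] w0(1) by auto
    \<comment> \<open>The added first disjunct contains the empty clause, so it cannot be the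
      guess.\<close>
    then have "w0 \<noteq> [[]]" by (auto simp: sat_cnf_def sat_clause_def)
    moreover have "inj_on a {..<k}"
    proof (rule inj_onI)
      fix i j assume ij: "i \<in> {..<k}" "j \<in> {..<k}" "a i = a j"
      let ?c = "[(a i, True), (a i, False)]"
      \<comment> \<open>The tautology on \<open>a i\<close> is always true, but an item of it
        survives only if a single slot selects \<open>a i\<close>.\<close>
      have c: "?c \<in> set (W ! (g - 1))" using ij(1) ga(3) unfolding w0(1) by auto
      show "i = j"
      proof (rule fitting_sound(2)[OF fit[OF c] len[OF gW c]])
        show "(a i, True) \<in> set ?c" by simp
      qed (use ij in simp_all)
    qed
    ultimately show "weighted_satisfiable G k"
      unfolding weighted_satisfiable_iff[OF wf weft depth] using ga(3) sat w0(2) by blast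
  next
    assume "weighted_satisfiable G k"
    then obtain a w0 where a: "inj_on a {..<k}" "a ` {..<k} \<subseteq> set (inputs G)"
      and w0: "w0 \<in> set (output_dnf (Suc d) G)" "sat_cnf (\<lambda>i. i \<in> a ` {..<k}) w0"
      unfolding weighted_satisfiable_iff[OF wf weft depth] by blast
    have "w0 @ ?triv \<in> set W" using w0(1) unfolding W by auto
    then obtain j where j: "j < length W" "W ! j = w0 @ ?triv" by (auto simp: in_set_conv_nth)
    interpret selection "2 ^ Suc d" k W "Suc j" a using sel[of "Suc j"] j(1) by simp
    have "fitting cl = 1" if cl: "cl \<in> set (W ! j)" for cl
    proof (rule fitting_complete[OF a(1)])
      show "length cl \<le> 2 ^ Suc d" using len[OF nth_mem[OF j(1)] cl] .
      show "sat_clause (\<lambda>i. i \<in> a ` {..<k}) cl"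
        using cl w0(2) unfolding j(2) by (auto simp: sat_cnf_def) (auto simp: sat_clause_def)
    qed
    then show ?L using j(1) a(2) by (intro exI[of _ "Suc j"] exI[of _ a]) simp
  qed
qed

lemma kills_dummy: "1 \<le> w \<Longrightarrow> guess_kills w (0, True, [])" "slot_kills i x (0, True, [])"
  by (auto simp: guess_kills_def slot_kills_def)

lemma choice_instance_items:
  assumes "ins \<noteq> []" "W \<noteq> []"
  shows "choice_instance (all_items f [0..<k] k W) (families k ins W)
    (length (capacity_list f [0..<k] k W))"
proof
  show "families k ins W \<noteq> []" by (simp add: families_def)
  show "Ks \<noteq> []" if "Ks \<in> set (families k ins W)" for Ks
  proof -
    have "Suc 0 \<le> length W" using assms(2) by (cases W) auto
    then show ?thesis using that assms(1) by (auto simp: families_def)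
  qed
  show "\<exists>it\<in>set (all_items f [0..<k] k W). K it"
    if Ks: "Ks \<in> set (families k ins W)" "K \<in> set Ks" for Ks K
  proof
    show "(0, True, []) \<in> set (all_items f [0..<k] k W)" by (simp add: all_items_def)
    show "K (0, True, [])"
    proof (cases "K \<in> guess_kills ` {1..length W}")
      case True
      then show ?thesis using kills_dummy(1) by auto
    next
      case False
      then have "K \<notin> set (map guess_kills (map fst (enumerate 1 W)))"
        by (simp only: set_map[of guess_kills] guess_labels) simp
      then show ?thesis using Ks kills_dummy(2) unfolding families_def by auto
    qed
  qed
qed (simp_all add: all_items_def capacity_list_def length_families del: length_concat)

definition to_problem :: "(nat \<times> precedence list \<times> nat) \<times> nat \<Rightarrow> tree \<times> nat" where
  "to_problem r = (enc_sched (\<lparr>machines = fst (fst r), constraints = fst (snd (fst r))\<rparr>,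
     snd (snd (fst r))), snd r)"

lemma ptime_to_problem: "ptime (encp (enc_list enc_gate) enc_nat) enc_param
    (\<lambda>z. to_problem (reduction \<gamma> f (fst z) (snd z)))"
proof (rule ptime_recode[OF ptime_reduction])
  show "encp (encp enc_nat (encp (enc_list enc_precedence) enc_nat)) enc_nat (reduction \<gamma> f (fst z) (snd z))
      = enc_param (to_problem (reduction \<gamma> f (fst z) (snd z)))" for z
    by (simp add: to_problem_def enc_param_def enc_sched_def encp_def split: prod.split)
qed

lemma scheduling_instance_iff:
  "(enc_sched (I, T), k) \<in> instances (or_and_scheduling \<gamma>) \<longleftrightarrow>
     k = num_successors I \<and> wf_sched I \<and> (\<exists>C. feasible I C)"
  by (auto simp: or_and_scheduling_def dest: injD[OF inj_enc_sched])

lemma scheduling_yes_iff: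
  "(enc_sched (I, T), k) \<in> yes_instances (or_and_scheduling \<gamma>) \<longleftrightarrow>
     k = num_successors I \<and> wf_sched I \<and> (\<exists>C. feasible I C \<and> objective_value \<gamma> I C \<le> T)"
  by (auto simp: or_and_scheduling_def dest: injD[OF inj_enc_sched])

lemma circuit_yes_iff:
  assumes "wf_circuit G" "weft_at_most G w" "depth_at_most G d"
  shows "(enc_circuit G, k) \<in> yes_instances (weighted_circuit_sat w d) \<longleftrightarrow> weighted_satisfiable G k"
  using assms by (auto simp: weighted_circuit_sat_def dest: injD[OF inj_enc_circuit])

lemma weighted_satisfiable_le:
  assumes "weighted_satisfiable G k"
  shows "k \<le> length G"
proof -
  obtain v where "weight G v = k" using assms by (auto simp: weighted_satisfiable_def)
  moreover have "weight G v \<le> card {..<length G}"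
    unfolding weight_def by (intro card_mono) auto
  ultimately show ?thesis by simp
qed

text \<open>One free job is feasible, but it completes no earlier than time 1 and so misses the
  bound 0 for both objectives.\<close>

lemma no_instance:
  defines "I \<equiv> \<lparr>machines = 1, constraints = [TrueConst]\<rparr>"
  shows "(enc_sched (I, 0), 0) \<in> instances (or_and_scheduling \<gamma>)"
    and "(enc_sched (I, 0), 0) \<notin> yes_instances (or_and_scheduling \<gamma>)"
proof -
  have j: "jobs I = {1}" "prec_of I 1 = TrueConst" by (auto simp: I_def jobs_def prec_of_def)
  have card: "card {j \<in> {1}. C j = t} \<le> 1" for C :: "nat \<Rightarrow> nat" and t
    by (rule order_trans[OF card_mono[of "{1}"]]) auto
  then have "feasible I (\<lambda>_. 1)" using j by (simp add: feasible_def schedule_def) (simp add: I_def)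
  then show "(enc_sched (I, 0), 0) \<in> instances (or_and_scheduling \<gamma>)"
    unfolding scheduling_instance_iff using j by (auto simp: num_successors_def wf_sched_def)
  have "\<not> objective_value \<gamma> I C \<le> 0" if "feasible I C" for C
    using that j by (cases \<gamma>) (auto simp: feasible_def schedule_def)
  then show "(enc_sched (I, 0), 0) \<notin> yes_instances (or_and_scheduling \<gamma>)"
    unfolding scheduling_yes_iff by blast
qed

lemma reduction_eq:
  fixes d k :: nat and G :: circuit
  assumes "k \<le> length G"
  defines "W \<equiv> guesses (Suc d) G" and "f \<equiv> 2 ^ Suc d"
  defines "m \<equiv> length (capacity_list f [0..<k] k W)"
  shows "reduction \<gamma> (Suc d) G k = ((m, choice_constraints (all_items f [0..<k] k W)
    (families k (inputs G) W), bound_for \<gamma> m), Suc k)"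
proof -
  have "list_ex (\<lambda>z. fst z = k) (enumerate 0 (Input # G))"
  proof -
    have "k \<in> set (map fst (enumerate 0 (Input # G)))" using assms(1) unfolding map_fst_enumerate by auto
    then show ?thesis unfolding list_ex_iff set_map by blast
  qed
  then show ?thesis
    using slots_eq[OF assms(1)]
    by (cases \<gamma>) (simp_all add: reduction_def W_def f_def m_def choice_constraints_def families_def
        comp_def Let_def del: map_fst_enumerate)
qed

lemma reduction_correct:
  fixes \<gamma> :: objective and k :: nat
  assumes wf: "wf_circuit G" and weft: "weft_at_most G 1" and depth: "depth_at_most G d"
  defines "r \<equiv> to_problem (reduction \<gamma> (Suc d) G k)"
  shows "r \<in> instances (or_and_scheduling \<gamma>)"
    and "r \<in> yes_instances (or_and_scheduling \<gamma>) \<longleftrightarrow> weighted_satisfiable G k"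
    and "snd r \<le> Suc k"
proof -
  have "r \<in> instances (or_and_scheduling \<gamma>) \<and>
    (r \<in> yes_instances (or_and_scheduling \<gamma>) \<longleftrightarrow> weighted_satisfiable G k) \<and> snd r \<le> Suc k"
  proof (cases "k \<le> length G")
    case True
    define W where "W = guesses (Suc d) G"
    let ?f = "2 ^ Suc d"
    let ?its = "all_items ?f [0..<k] k W" and ?F = "families k (inputs G) W"
    let ?m = "length (capacity_list ?f [0..<k] k W)"
    have G: "0 < length G" using wf by (simp add: wf_circuit_def)
    \<comment> \<open>Gate 0 has nothing to refer to and is therefore an input, so the families of
      the slots are nonempty.\<close>
    have "preds (G ! 0) = []" using preds_less[OF wf G] by (cases "preds (G ! 0)") auto
    then have "0 \<in> set (inputs G)" using no_preds[OF wf G] G by (simp add: set_inputs)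
    then interpret choice_instance ?its ?F ?m
      by (intro choice_instance_items) (auto simp: W_def guesses_def)
    have r: "r = (enc_sched (I, bound_for \<gamma> ?m), Suc k)"
      unfolding r_def reduction_eq[OF True] to_problem_def I_def by (simp add: W_def)
    have "(\<exists>C. feasible I C \<and> objective_value \<gamma> I C \<le> bound_for \<gamma> ?m) \<longleftrightarrow> weighted_satisfiable G k"
      unfolding yes_iff
      by (rule trans[OF families_choice_iff guesses_choice_iff(1)[OF wf weft depth, folded W_def]])
        (rule guesses_choice_iff(2)[OF wf weft depth, folded W_def])
    then show ?thesis
      unfolding r scheduling_instance_iff scheduling_yes_iff
      using wf_I feasible_exists num_successors_I by (simp add: length_families)
  next
    case False
    then have "\<not> list_ex (\<lambda>z. fst z = k) (enumerate 0 (Input # G))"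
      by (auto simp: list_ex_iff in_set_enumerate_eq)
    then have r: "r = (enc_sched (\<lparr>machines = 1, constraints = [TrueConst]\<rparr>, 0), 0)"
      by (simp add: r_def reduction_def to_problem_def)
    have "\<not> weighted_satisfiable G k" using False weighted_satisfiable_le by blast
    then show ?thesis unfolding r using no_instance by simp
  qed
  then show "r \<in> instances (or_and_scheduling \<gamma>)"
    and "r \<in> yes_instances (or_and_scheduling \<gamma>) \<longleftrightarrow> weighted_satisfiable G k"
    and "snd r \<le> Suc k" by blast+
qed

theorem theorem8:
  fixes \<gamma> :: objective
  shows "W_hard 1 (or_and_scheduling \<gamma>)"
  unfolding W_hard_def W_class_def
proof clarify
  fix A d assume A: "fpt_reducible A (weighted_circuit_sat 1 d)"
  show "fpt_reducible A (or_and_scheduling \<gamma>)"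
  \<comment> \<open>The depth \<open>d\<close> comes with the problem \<open>A\<close>, so it is a
    constant for the reduction that is composed here.\<close>
  proof (rule fpt_reducible_ptime[OF A ptime_to_problem[of \<gamma> "Suc d"]])
    show "ptime enc_nat enc_nat Suc" using ptime_Suc[OF ptime_id] .
    show "mono Suc" by (simp add: mono_def)
    fix x k assume "(x, k) \<in> instances (weighted_circuit_sat 1 d)"
    then obtain G where G: "x = enc_circuit G" "wf_circuit G" "weft_at_most G 1" "depth_at_most G d"
      by (auto simp: weighted_circuit_sat_def)
    let ?r = "to_problem (reduction \<gamma> (Suc d) G k)"
    show "\<exists>y x' k'. encp (enc_list enc_gate) enc_nat y = enc_param (x, k) \<and>
      to_problem (reduction \<gamma> (Suc d) (fst y) (snd y)) = (x', k') \<and>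
      (x', k') \<in> instances (or_and_scheduling \<gamma>) \<and>
      ((x', k') \<in> yes_instances (or_and_scheduling \<gamma>) \<longleftrightarrow>
        (x, k) \<in> yes_instances (weighted_circuit_sat 1 d)) \<and> k' \<le> Suc k"
      by (rule exI[of _ "(G, k)"], rule exI[of _ "fst ?r"], rule exI[of _ "snd ?r"])
        (use reduction_correct[OF G(2-4), of \<gamma> k] circuit_yes_iff[OF G(2-4), of k] in
          \<open>simp add: G(1) enc_param_def enc_circuit_def\<close>)
  qed
qed

end
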